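(* Let $X,\hat U,\hat\Sigma,\tilde V,\Delta X\in\mathbb C^{n\times n}$, with $\tilde V$ unitary and $\hat\Sigma$ diagonal with positive diagonal entries in descending order, satisfy $$X=\hat U\hat\Sigma\tilde V^*+\Delta X,\qquad \|\Delta X(i,:)\|_2\le\varepsilon_{\mathrm{SVD}}\|X(i,:)\|_2\ \text{ for all } i,\qquad \|\hat U^*\hat U-I\|_F\le\varepsilon_{\mathrm U},$$ and assume $$\varepsilon_{\mathrm U}\|\hat\Sigma\|_2\|\hat\Sigma^{-1}\|_2+\sqrt n\,\bigl(\varepsilon_{\mathrm{SVD}}+\sqrt n\,\gamma_n+\varepsilon_{\mathrm{qr}}+\sqrt n\,\gamma_n\varepsilon_{\mathrm{qr}}\bigr)(1+\varepsilon_{\mathrm U})\|X\|_2\|\hat\Sigma^{-1}\|_2<\sqrt{\tfrac32}-1.$$ Let $X^*\hat U=Q_1R_1$ be the (exact) QR factorization, $Y_1=XQ_1$, and $Y_2=X\tilde V$. Then $$\|Y_1\hat\Sigma^{-1}-\hat U\|_2\le\varepsilon_{\mathrm U}+(1+\varepsilon_{\mathrm U})\Bigl(\varepsilon_{\mathrm U}+(\sqrt2+\sqrt3)\bigl(\varepsilon_{\mathrm U}+\sqrt n\,\varepsilon_{\mathrm{SVD}}\|Z_r^{-1}\|_2\bigr)\Bigr)$$ and $$\|Y_2\hat\Sigma^{-1}-\hat U\|_2\le n\,\varepsilon_{\mathrm{SVD}}\|X\|_2\|\hat\Sigma^{-1}\|_2,$$ where $X=D_rZ_r$ with $D_r$ diagonal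 and each row of $Z_r$ a unit vector.
   Context: $M(i,:)$ is the $i$-th row, $M^*$ the conjugate transpose, $\|\cdot\|_F$ the Frobenius norm, $\|\cdot\|_2$ the spectral (or Euclidean) norm. $\bm u$ and $\bm u_{\mathrm{low}}$ are the unit round-offs of the working and of the lower precision, $0<\bm u\le\bm u_{\mathrm{low}}$, $n\bm u<1$, and $\gamma_n=n\bm u/(1-n\bm u)$. $\varepsilon_{\mathrm{SVD}},\varepsilon_{\mathrm U}\ge0$ are functions of $n$ and $\bm u_{\mathrm{low}}$; $\varepsilon_{\mathrm{qr}}\ge0$ is a function of $n$ and $\bm u$. QR factorization means $Q_1$ unitary and $R_1$ upper triangular with positive diagonal. Interpretation: $\hat U,\hat\Sigma$ are factors of an SVD of $X$ computed in lower precision, and everything computed in working precision ($Q_1,R_1,Y_1,Y_2$) is regarded as exact. *)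

theory Defs
  imports "HOL-Analysis.Analysis"
begin

text \<open>
  An \<open>n \<times> n\<close> complex matrix is an element of \<open>complex ^ 'n ^ 'n\<close> with \<open>n = CARD('n)\<close>.
  The linear order on the index type is needed only for triangularity and for the
  descending order of the singular values.

  The norm that the library puts on \<open>complex ^ 'n ^ 'n\<close> (the Euclidean norm of the vector of
  Euclidean norms of the rows) is the Frobenius norm, not the spectral norm.
\<close>

lemma norm_matrix_eq_frobenius:
  fixes A :: "complex ^ 'n ^ 'm"
  shows "norm A = sqrt (\<Sum>i\<in>UNIV. \<Sum>j\<in>UNIV. (cmod (A $ i $ j))\<^sup>2)"
  by (simp add: norm_vec_def L2_set_def sum_nonneg)

definition spectral_norm :: "complex ^ 'n ^ 'm \<Rightarrow> real" where
  "spectral_norm A = onorm (\<lambda>x. A *v x)"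

definition ctranspose :: "complex ^ 'n ^ 'm \<Rightarrow> complex ^ 'm ^ 'n" where
  "ctranspose A = (\<chi> i j. cnj (A $ j $ i))"

definition unitary_matrix :: "complex ^ 'n ^ 'n \<Rightarrow> bool" where
  "unitary_matrix Q \<longleftrightarrow> ctranspose Q ** Q = mat 1 \<and> Q ** ctranspose Q = mat 1"

definition diagonal_matrix :: "complex ^ 'n ^ 'n \<Rightarrow> bool" where
  "diagonal_matrix D \<longleftrightarrow> (\<forall>i j. i \<noteq> j \<longrightarrow> D $ i $ j = 0)"

definition upper_triangular_matrix :: "complex ^ 'n::{finite,linorder} ^ 'n::{finite,linorder} \<Rightarrow> bool" where
  "upper_triangular_matrix R \<longleftrightarrow> (\<forall>i j. j < i \<longrightarrow> R $ i $ j = 0)"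

definition positive_diagonal :: "complex ^ 'n ^ 'n \<Rightarrow> bool" where
  "positive_diagonal A \<longleftrightarrow> (\<forall>i. A $ i $ i \<in> \<real> \<and> 0 < Re (A $ i $ i))"

definition descending_diagonal :: "complex ^ 'n::{finite,linorder} ^ 'n::{finite,linorder} \<Rightarrow> bool" where
  "descending_diagonal A \<longleftrightarrow> (\<forall>i j. i \<le> j \<longrightarrow> Re (A $ j $ j) \<le> Re (A $ i $ i))"

definition is_QR :: "complex ^ 'n::{finite,linorder} ^ 'n::{finite,linorder}
    \<Rightarrow> complex ^ 'n::{finite,linorder} ^ 'n::{finite,linorder}
    \<Rightarrow> complex ^ 'n::{finite,linorder} ^ 'n::{finite,linorder} \<Rightarrow> bool" where
  "is_QR A Q R \<longleftrightarrow>
     A = Q ** R \<and> unitary_matrix Q \<and> upper_triangular_matrix R \<and> positive_diagonal R"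

definition roundoff_gamma :: "nat \<Rightarrow> real \<Rightarrow> real" where
  "roundoff_gamma n u = real n * u / (1 - real n * u)"

end

theory Submission
  imports Defs
begin

text \<open>
  Write \<open>W = U\<^sup>*U\<close>, and let \<open>H\<close> be the matrix with \<open>\<Delta>X\<^sup>* = H V\<Sigma>U\<^sup>*\<close>, so that
  \<open>X\<^sup>*U = (I + H)V\<Sigma>W\<close>. Both \<open>W\<close> and \<open>I + H\<close> are close to the identity: \<open>\<parallel>W - I\<parallel>\<^sub>F\<close> is at most
  \<open>\<epsilon>U\<close>, and for \<open>H\<close> there are two estimates. The smallness hypothesis controls
  \<open>\<parallel>H\<parallel>\<^sub>F \<le> \<parallel>\<Delta>X\<parallel>\<^sub>F (1 + \<epsilon>U) \<parallel>\<Sigma>\<^sup>-\<^sup>1\<parallel>\<close>, so that \<open>\<epsilon>U + \<parallel>H\<parallel>\<^sub>F < sqrt (3/2) - 1\<close>. The row scaling \<open>X = DZ\<close>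
  gives the estimate that enters the result: \<open>\<Delta>X = XK\<close> with \<open>\<parallel>K\<parallel>\<^sub>F \<le> \<eta>\<close>, where
  \<open>\<eta> = sqrt n \<epsilon>SVD \<parallel>Z\<^sup>-\<^sup>1\<parallel>\<close>, because \<open>K = Z\<^sup>-\<^sup>1(D\<^sup>-\<^sup>1\<Delta>X)\<close> and the rows of \<open>D\<^sup>-\<^sup>1\<Delta>X\<close> have norm
  at most \<open>\<epsilon>SVD\<close>; then \<open>H = K\<^sup>*(I + H)\<close>.
  
  Since \<open>U\<^sup>*Y\<^sub>1 = (X\<^sup>*U)\<^sup>*Q\<^sub>1 = R\<^sub>1\<^sup>*\<close>, the first bound comes down to
  \<open>Y\<^sub>1\<Sigma>\<^sup>-\<^sup>1 - U = U\<^sup>-\<^sup>*((R\<^sub>1\<^sup>*\<Sigma>\<^sup>-\<^sup>1 - I) - (W - I))\<close>, hence to estimating \<open>\<Sigma>\<^sup>-\<^sup>1R\<^sub>1 - I\<close> without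
  the condition number of \<open>\<Sigma>\<close>. This is the core of the proof (lemma
  \<open>R_factor_left_scaled_perturbation\<close>), and it rests on the fact that conjugation
  \<open>T \<mapsto> \<Sigma>\<^sup>-\<^sup>1T\<Sigma>\<close> does not enlarge an upper triangular \<open>T - I\<close> when the diagonal of \<open>\<Sigma>\<close> descends
  (lemma \<open>norm_conjugate_minus_mat_1_le\<close>). Take the Cholesky factorization \<open>W = C\<^sup>*C\<close>. The
  matrix \<open>L = \<Sigma>C\<^sup>*\<Sigma>\<^sup>-\<^sup>1\<close> is the adjoint of such a conjugate, hence close to \<open>I\<close>, and
  \<open>\<Sigma>W = L\<Sigma>C\<close>. Therefore \<open>X\<^sup>*U = (I + H)V L\<Sigma>C\<close>, and if \<open>T\<close> is the R factor of the
  near-identity matrix \<open>V\<^sup>*(I + H)VL\<close>, then \<open>R\<^sub>1 = T\<Sigma>C\<close> by uniqueness of the QR factorization.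
  Now \<open>\<Sigma>\<^sup>-\<^sup>1R\<^sub>1 = (\<Sigma>\<^sup>-\<^sup>1T\<Sigma>)C\<close> is a product of two matrices close to \<open>I\<close>.
  
  The Cholesky and R factors of near-identity matrices are controlled by a fixed point argument
  (lemmas \<open>cholesky_near_identity\<close> and \<open>QR_near_identity\<close>). Applied to \<open>V\<^sup>*(I + H)VL\<close> at once it
  would give too large a constant when \<open>\<parallel>H\<parallel>\<^sub>F\<close> is close to \<open>sqrt (3/2) - 1\<close>; the factor \<open>I + H\<close> is
  therefore split into two factors of about half the size each.
  
  The second bound is immediate from \<open>Y\<^sub>2\<Sigma>\<^sup>-\<^sup>1 - U = \<Delta>X V\<Sigma>\<^sup>-\<^sup>1\<close>.
\<close>

section \<open>Conjugate transposes, spectral and Frobenius norms\<close>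

lemma ctranspose_nth [simp]: "ctranspose A $ i $ j = cnj (A $ j $ i)"
  by (simp add: ctranspose_def)

lemma ctranspose_ctranspose [simp]: "ctranspose (ctranspose A) = A"
  by (simp add: vec_eq_iff)

lemma ctranspose_mult: "ctranspose (A ** B) = ctranspose B ** ctranspose A"
  by (simp add: vec_eq_iff matrix_matrix_mult_def mult.commute)

lemma ctranspose_add: "ctranspose (A + B) = ctranspose A + ctranspose B"
  by (simp add: vec_eq_iff)

lemma ctranspose_diff: "ctranspose (A - B) = ctranspose A - ctranspose B"
  by (simp add: vec_eq_iff)

lemma ctranspose_mat_1 [simp]: "ctranspose (mat 1) = mat 1"
  by (simp add: vec_eq_iff mat_def)

lemma matrix_mult_diff_left: "(A - B) ** C = A ** C - B ** (C :: complex ^ 'n ^ 'm)"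
  by (simp add: vec_eq_iff matrix_matrix_mult_def sum_subtractf left_diff_distrib)

lemma matrix_mult_diff_right: "A ** (B - C) = A ** B - A ** (C :: complex ^ 'n ^ 'm)"
  by (simp add: vec_eq_iff matrix_matrix_mult_def sum_subtractf right_diff_distrib)

lemma matrix_mult_add_left: "(A + B) ** C = A ** C + B ** (C :: complex ^ 'n ^ 'm)"
  by (simp add: vec_eq_iff matrix_matrix_mult_def sum.distrib distrib_right)

lemma bounded_linear_matrix_vector: "bounded_linear (\<lambda>x. A *v (x :: complex ^ 'n))"
proof -
  have "A *v (r *\<^sub>R x) = r *\<^sub>R (A *v x)" for r and x :: "complex ^ 'n"
    by (simp add: vec_eq_iff matrix_vector_mult_def scaleR_right.sum)
  then have "linear (\<lambda>x. A *v (x :: complex ^ 'n))"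
    by (intro linearI) (simp_all add: matrix_vector_right_distrib)
  then show ?thesis
    by (simp add: linear_conv_bounded_linear)
qed

lemma norm_matrix_vector_le: "norm (A *v x) \<le> spectral_norm A * norm (x :: complex ^ 'n)"
  unfolding spectral_norm_def by (rule onorm[OF bounded_linear_matrix_vector])

lemma spectral_norm_nonneg [simp]: "0 \<le> spectral_norm A"
  unfolding spectral_norm_def by (rule onorm_pos_le[OF bounded_linear_matrix_vector])

lemma spectral_norm_leI:
  assumes "0 \<le> b" "\<And>x. norm (A *v x) \<le> b * norm x"
  shows "spectral_norm A \<le> b"
  unfolding spectral_norm_def using assms by (rule onorm_bound)

lemma spectral_norm_mult_le: "spectral_norm (A ** B) \<le> spectral_norm A * spectral_norm B"
proof (rule spectral_norm_leI)
  fix x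
  have "norm ((A ** B) *v x) = norm (A *v (B *v x))"
    by (simp add: matrix_vector_mul_assoc)
  also have "\<dots> \<le> spectral_norm A * (spectral_norm B * norm x)"
    by (meson norm_matrix_vector_le mult_left_mono order_trans spectral_norm_nonneg)
  finally show "norm ((A ** B) *v x) \<le> spectral_norm A * spectral_norm B * norm x"
    by (simp add: mult.assoc)
qed (simp add: spectral_norm_nonneg)

text \<open>
  The inner product here is the real part of the Hermitian one. It suffices below because both
  induce the same norm.
\<close>

lemma inner_ctranspose: "(A *v x) \<bullet> y = x \<bullet> (ctranspose A *v y)"
proof -
  have "(A *v x) \<bullet> y = (\<Sum>i\<in>UNIV. \<Sum>j\<in>UNIV. (A $ i $ j * x $ j) \<bullet> y $ i)"
    by (simp add: inner_vec_def matrix_vector_mult_def inner_sum_left)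
  also have "\<dots> = (\<Sum>j\<in>UNIV. \<Sum>i\<in>UNIV. (A $ i $ j * x $ j) \<bullet> y $ i)"
    by (rule sum.swap)
  also have "\<dots> = (\<Sum>j\<in>UNIV. \<Sum>i\<in>UNIV. x $ j \<bullet> (cnj (A $ i $ j) * y $ i))"
    by (simp add: inner_complex_def algebra_simps)
  also have "\<dots> = x \<bullet> (ctranspose A *v y)"
    by (simp add: inner_vec_def matrix_vector_mult_def inner_sum_right)
  finally show ?thesis .
qed

lemma spectral_norm_ctranspose_le: "spectral_norm (ctranspose A) \<le> spectral_norm A"
proof (rule spectral_norm_leI[OF spectral_norm_nonneg])
  fix y
  have "(norm (ctranspose A *v y))\<^sup>2 = (A *v (ctranspose A *v y)) \<bullet> y"
    by (simp add: inner_ctranspose power2_norm_eq_inner)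
  also have "\<dots> \<le> norm (A *v (ctranspose A *v y)) * norm y"
    by (rule norm_cauchy_schwarz)
  also have "\<dots> \<le> (spectral_norm A * norm (ctranspose A *v y)) * norm y"
    by (simp add: mult_right_mono norm_matrix_vector_le)
  finally have "norm (ctranspose A *v y) * norm (ctranspose A *v y)
      \<le> norm (ctranspose A *v y) * (spectral_norm A * norm y)"
    by (simp add: power2_eq_square mult_ac)
  then show "norm (ctranspose A *v y) \<le> spectral_norm A * norm y"
    by (metis mult_le_cancel_left_pos mult_nonneg_nonneg norm_ge_zero order_le_less
        spectral_norm_nonneg)
qed

lemma spectral_norm_ctranspose [simp]: "spectral_norm (ctranspose A) = spectral_norm A"
  using spectral_norm_ctranspose_le[of A] spectral_norm_ctranspose_le[of "ctranspose A"] by simp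

lemma norm_matrix_sq: "(norm A)\<^sup>2 = (\<Sum>i\<in>UNIV. \<Sum>j\<in>UNIV. (cmod (A $ i $ j))\<^sup>2)"
  for A :: "complex ^ 'n ^ 'm"
  by (simp add: norm_matrix_eq_frobenius sum_nonneg)

lemma norm_vector_sq: "(norm x)\<^sup>2 = (\<Sum>i\<in>UNIV. (cmod (x $ i))\<^sup>2)"
  for x :: "complex ^ 'n"
  by (simp add: norm_vec_def L2_set_def sum_nonneg)

lemma norm_sq_rows: "(norm A)\<^sup>2 = (\<Sum>i\<in>UNIV. (norm (row i A))\<^sup>2)"
  for A :: "complex ^ 'n ^ 'm"
  by (simp add: norm_matrix_sq norm_vector_sq row_def)

lemma norm_sq_columns: "(norm A)\<^sup>2 = (\<Sum>j\<in>UNIV. (norm (column j A))\<^sup>2)"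
  for A :: "complex ^ 'n ^ 'm"
  unfolding norm_matrix_sq norm_vector_sq column_def by (subst sum.swap) simp

lemma norm_ctranspose [simp]: "norm (ctranspose A) = norm A"
proof -
  have "(norm (ctranspose A))\<^sup>2 = (norm A)\<^sup>2"
    unfolding norm_matrix_sq by (subst sum.swap) simp
  then show ?thesis by simp
qed

lemma column_mult: "column j (A ** B) = A *v column j (B :: complex ^ 'n ^ 'm)"
  by (simp add: vec_eq_iff column_def matrix_matrix_mult_def matrix_vector_mult_def)

lemma norm_matrix_entrywise_mono:
  fixes A B :: "complex ^ 'n ^ 'm"
  assumes "\<And>i j. cmod (A $ i $ j) \<le> cmod (B $ i $ j)"
  shows "norm A \<le> norm B"
proof -
  have "(norm A)\<^sup>2 \<le> (norm B)\<^sup>2"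
    unfolding norm_matrix_sq using assms by (intro sum_mono power_mono) auto
  then show ?thesis by simp
qed

lemma frobenius_mult_le_spectral_left: "norm (A ** B) \<le> spectral_norm A * norm (B :: complex ^ 'n ^ 'm)"
proof -
  have "(norm (A ** B))\<^sup>2 = (\<Sum>j\<in>UNIV. (norm (A *v column j B))\<^sup>2)"
    by (simp add: norm_sq_columns column_mult)
  also have "\<dots> \<le> (\<Sum>j\<in>UNIV. (spectral_norm A * norm (column j B))\<^sup>2)"
    by (intro sum_mono power_mono norm_matrix_vector_le) auto
  also have "\<dots> = (spectral_norm A * norm B)\<^sup>2"
    by (simp add: norm_sq_columns power_mult_distrib sum_distrib_left)
  finally show ?thesis
    by (rule power2_le_imp_le) (simp add: spectral_norm_nonneg)
qed

lemma frobenius_mult_le_spectral_right: "norm (A ** B) \<le> norm A * spectral_norm (B :: complex ^ 'n ^ 'm)"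
  using frobenius_mult_le_spectral_left[of "ctranspose B" "ctranspose A"]
  by (simp flip: ctranspose_mult add: mult.commute)

lemma spectral_norm_le_frobenius: "spectral_norm A \<le> norm A"
proof (rule spectral_norm_leI)
  fix x
  have "cmod ((A *v x) $ i) \<le> norm (row i A) * norm x" for i
  proof -
    have "cmod ((A *v x) $ i) \<le> (\<Sum>j\<in>UNIV. \<bar>cmod (A $ i $ j)\<bar> * \<bar>cmod (x $ j)\<bar>)"
      by (simp add: matrix_vector_mult_def sum_norm_le norm_mult)
    also have "\<dots> \<le> L2_set (\<lambda>j. cmod (A $ i $ j)) UNIV * L2_set (\<lambda>j. cmod (x $ j)) UNIV"
      by (rule L2_set_mult_ineq)
    finally show ?thesis by (simp add: norm_vec_def row_def)
  qed
  then have "(norm (A *v x))\<^sup>2 \<le> (\<Sum>i\<in>UNIV. (norm (row i A) * norm x)\<^sup>2)"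
    unfolding norm_vector_sq[of "A *v x"] by (intro sum_mono power_mono) auto
  also have "\<dots> = (norm A * norm x)\<^sup>2"
    by (simp add: norm_sq_rows power_mult_distrib sum_distrib_right)
  finally show "norm (A *v x) \<le> norm A * norm x"
    by (rule power2_le_imp_le) simp
qed simp

lemma frobenius_mult_le: "norm (A ** B) \<le> norm A * norm (B :: complex ^ 'n ^ 'm)"
  using frobenius_mult_le_spectral_left[of A B] spectral_norm_le_frobenius[of A]
  by (meson mult_right_mono norm_ge_zero order_trans)

lemma norm_row_le_spectral_norm: "norm (row i A) \<le> spectral_norm A"
proof -
  have "norm (row i A) = norm (column i (ctranspose A))"
    by (simp add: row_def column_def norm_vec_def)
  also have "column i (ctranspose A) = ctranspose A *v axis i 1"
    by (simp add: vec_eq_iff column_def matrix_vector_mult_def axis_def if_distrib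
        cong: if_cong)
  also have "norm \<dots> \<le> spectral_norm (ctranspose A) * norm (axis i (1::complex))"
    by (rule norm_matrix_vector_le)
  also have "\<dots> = spectral_norm A" by (simp add: norm_axis_1)
  finally show ?thesis .
qed

section \<open>Unitary and invertible matrices\<close>

lemma norm_unitary_vector:
  assumes "unitary_matrix Q"
  shows "norm (Q *v x) = norm x"
proof -
  have "(norm (Q *v x))\<^sup>2 = x \<bullet> ((ctranspose Q ** Q) *v x)"
    by (simp add: power2_norm_eq_inner inner_ctranspose matrix_vector_mul_assoc)
  then have "(norm (Q *v x))\<^sup>2 = (norm x)\<^sup>2"
    using assms by (simp add: unitary_matrix_def power2_norm_eq_inner)
  then show ?thesis by simp
qed

lemma unitary_ctranspose: "unitary_matrix Q \<Longrightarrow> unitary_matrix (ctranspose Q)"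
  by (simp add: unitary_matrix_def)

lemma unitary_mult:
  assumes "unitary_matrix P" "unitary_matrix Q"
  shows "unitary_matrix (P ** Q)"
proof -
  have "ctranspose Q ** ctranspose P ** (P ** Q) = ctranspose Q ** (ctranspose P ** P) ** Q"
    "P ** Q ** (ctranspose Q ** ctranspose P) = P ** (Q ** ctranspose Q) ** ctranspose P"
    by (simp_all add: matrix_mul_assoc)
  then show ?thesis using assms by (simp add: unitary_matrix_def ctranspose_mult)
qed

lemma norm_unitary_mult_left:
  assumes "unitary_matrix Q"
  shows "norm (Q ** A) = norm A"
proof -
  have "(norm (Q ** A))\<^sup>2 = (norm A)\<^sup>2"
    by (simp add: norm_sq_columns column_mult norm_unitary_vector[OF assms])
  then show ?thesis by simp
qed

lemma norm_unitary_mult_right: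
  assumes "unitary_matrix Q"
  shows "norm (A ** Q) = norm A"
proof -
  have "norm (A ** Q) = norm (ctranspose Q ** ctranspose A)"
    by (simp flip: ctranspose_mult)
  then show ?thesis
    by (simp add: norm_unitary_mult_left unitary_ctranspose assms)
qed

lemma spectral_norm_unitary_le:
  assumes "unitary_matrix Q"
  shows "spectral_norm Q \<le> 1"
  by (rule spectral_norm_leI) (simp_all add: norm_unitary_vector[OF assms])

lemma matrix_inv_mult:
  assumes "invertible (A :: complex ^ 'n ^ 'n)"
  shows "A ** matrix_inv A = mat 1" "matrix_inv A ** A = mat 1"
proof -
  have "A ** matrix_inv A = mat 1 \<and> matrix_inv A ** A = mat 1"
    unfolding matrix_inv_def using assms unfolding invertible_def by (rule someI_ex)
  then show "A ** matrix_inv A = mat 1" "matrix_inv A ** A = mat 1" by auto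
qed

lemma invertible_mat_1_plus:
  fixes A :: "complex ^ 'n ^ 'n"
  assumes "norm A < 1"
  shows "invertible (mat 1 + A)"
proof -
  have "x = 0" if "(mat 1 + A) *v x = 0" for x
  proof (rule ccontr)
    assume "x \<noteq> 0"
    from that have "x = - (A *v x)"
      by (simp add: matrix_vector_mult_add_rdistrib eq_neg_iff_add_eq_0)
    then have "norm x = norm (A *v x)" by (metis norm_minus_cancel)
    also have "\<dots> \<le> norm A * norm x"
      by (meson norm_matrix_vector_le spectral_norm_le_frobenius mult_right_mono norm_ge_zero order_trans)
    also have "\<dots> < norm x" using assms \<open>x \<noteq> 0\<close> by simp
    finally show False by simp
  qed
  then show ?thesis
    by (metis invertible_def invertible_left_inverse matrix_left_invertible_ker)
qed

lemma norm_mult_minus_mat_1_le: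
  fixes A B :: "complex ^ 'n ^ 'n"
  assumes "norm (A - mat 1) \<le> a" "norm (B - mat 1) \<le> b"
  shows "norm (A ** B - mat 1) \<le> (1 + a) * (1 + b) - 1"
proof -
  have "A ** B - mat 1 = (A - mat 1) ** (B - mat 1) + (A - mat 1) + (B - mat 1)"
    by (simp add: matrix_mult_diff_left matrix_mult_diff_right)
  also have "norm \<dots> \<le> norm ((A - mat 1) ** (B - mat 1)) + norm (A - mat 1) + norm (B - mat 1)"
    by (meson norm_triangle_ineq norm_triangle_mono order_refl)
  also have "norm ((A - mat 1) ** (B - mat 1)) \<le> a * b"
    by (meson frobenius_mult_le assms mult_mono norm_ge_zero order_trans)
  finally show ?thesis using assms by (simp add: algebra_simps)
qed

section \<open>Triangular matrices and uniqueness of the QR factorization\<close>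

lemma upper_triangular_mult:
  assumes "upper_triangular_matrix A" "upper_triangular_matrix B"
  shows "upper_triangular_matrix (A ** B)"
proof -
  have "A $ i $ k * B $ k $ j = 0" if "j < i" for i j k
    using assms that unfolding upper_triangular_matrix_def
    by (metis less_le_trans linorder_le_less_linear mult_eq_0_iff)
  then show ?thesis
    unfolding upper_triangular_matrix_def matrix_matrix_mult_def vec_lambda_beta
    by (intro allI impI sum.neutral ballI)
qed

lemma upper_triangular_mult_diagonal:
  assumes "upper_triangular_matrix A" "upper_triangular_matrix B"
  shows "(A ** B) $ i $ i = A $ i $ i * B $ i $ i"
proof -
  have "A $ i $ k * B $ k $ i = 0" if "k \<noteq> i" for k
    using assms that unfolding upper_triangular_matrix_def
    by (metis linorder_neqE mult_eq_0_iff)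
  then have "(\<Sum>k\<in>UNIV. A $ i $ k * B $ k $ i) = (\<Sum>k\<in>{i}. A $ i $ k * B $ k $ i)"
    by (intro sum.mono_neutral_right) auto
  then show ?thesis by (simp add: matrix_matrix_mult_def)
qed

lemma positive_diagonal_mult:
  assumes "upper_triangular_matrix A" "upper_triangular_matrix B"
    and "positive_diagonal A" "positive_diagonal B"
  shows "positive_diagonal (A ** B)"
  using assms
  by (auto simp: positive_diagonal_def upper_triangular_mult_diagonal complex_is_Real_iff)

text \<open>
  The unitary matrix \<open>F = Q\<^sup>*Q'\<close> satisfies \<open>R = F R'\<close>. By induction on \<open>j\<close>, its \<open>j\<close>-th column
  is the \<open>j\<close>-th unit vector: the entries below the diagonal vanish since \<open>R\<close> and \<open>R'\<close> are
  triangular, those above vanish by orthogonality to the earlier columns, and the diagonal entry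
  is a positive number of modulus one. The order on the indices is linear and finite, so the
  induction is on the number of smaller indices.
\<close>

lemma QR_unique:
  fixes Q R Q' R' :: "complex ^ 'n::{finite,linorder} ^ 'n::{finite,linorder}"
  assumes "is_QR A Q R" "is_QR A Q' R'"
  shows "R = R'"
proof -
  define F where "F = ctranspose Q ** Q'"
  have Q: "unitary_matrix Q" "unitary_matrix Q'" and R: "upper_triangular_matrix R" "positive_diagonal R"
    and R': "upper_triangular_matrix R'" "positive_diagonal R'" and eq: "Q ** R = Q' ** R'"
    using assms by (auto simp: is_QR_def)
  have F: "unitary_matrix F"
    unfolding F_def by (intro unitary_mult unitary_ctranspose Q)
  have "R = (ctranspose Q ** Q) ** R"
    using Q by (simp add: unitary_matrix_def)
  also have "\<dots> = F ** R'"
    by (simp add: F_def eq flip: matrix_mul_assoc)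
  finally have RF: "R = F ** R'" .
  have "\<forall>i. F $ i $ j = (if i = j then 1 else 0)" for j
  proof (induction "card {k. k < j}" arbitrary: j rule: less_induct)
    case less
    have before: "F $ i $ k = (if i = k then 1 else 0)" if "k < j" for i k
    proof -
      have "{l. l < k} \<subset> {l. l < j}" using that by auto
      then have "card {l. l < k} < card {l. l < j}" by (intro psubset_card_mono) auto
      then show ?thesis using less by blast
    qed
    have R_entry: "R $ i $ j = F $ i $ j * R' $ j $ j" if "j \<le> i" for i
    proof -
      have "F $ i $ k * R' $ k $ j = 0" if "k \<noteq> j" for k
      proof (cases "k < j")
        case True
        then show ?thesis using before[OF True, of i] \<open>j \<le> i\<close> by auto
      next
        case False
        then show ?thesis using R'(1) that by (simp add: upper_triangular_matrix_def)
      qed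
      then have "(\<Sum>k\<in>UNIV. F $ i $ k * R' $ k $ j) = (\<Sum>k\<in>{j}. F $ i $ k * R' $ k $ j)"
        by (intro sum.mono_neutral_right) auto
      then show ?thesis unfolding RF by (simp add: matrix_matrix_mult_def)
    qed
    have R'_pos: "R' $ j $ j \<noteq> 0" "R' $ j $ j = of_real (Re (R' $ j $ j))" "Re (R' $ j $ j) > 0"
      using R'(2) by (auto simp: positive_diagonal_def complex_is_Real_iff complex_eq_iff)
        (metis less_irrefl zero_complex.sel(1))
    have R_pos: "R $ j $ j = of_real (Re (R $ j $ j))" "Re (R $ j $ j) > 0"
      using R(2) by (auto simp: positive_diagonal_def complex_is_Real_iff complex_eq_iff)
    have below: "F $ i $ j = 0" if "j < i" for i
      using R_entry[of i] that R(1) R'_pos by (auto simp: upper_triangular_matrix_def)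
    have above: "F $ k $ j = 0" if "k < j" for k
    proof -
      have "0 = (ctranspose F ** F) $ k $ j"
        using F that by (simp add: unitary_matrix_def mat_def)
      also have "\<dots> = (\<Sum>i\<in>UNIV. if i = k then F $ i $ j else 0)"
        unfolding matrix_matrix_mult_def vec_lambda_beta ctranspose_nth
        by (rule sum.cong) (auto simp: before[OF that])
      also have "\<dots> = F $ k $ j" by simp
      finally show ?thesis by simp
    qed
    have off: "F $ i $ j = 0" if "i \<noteq> j" for i
      using below above that by (metis linorder_neqE)
    have "1 = (ctranspose F ** F) $ j $ j"
      using F by (simp add: unitary_matrix_def mat_def)
    also have "\<dots> = (\<Sum>i\<in>{j}. cnj (F $ i $ j) * F $ i $ j)"
      unfolding matrix_matrix_mult_def vec_lambda_beta ctranspose_nth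
      by (rule sum.mono_neutral_right) (auto simp: off)
    finally have "of_real ((cmod (F $ j $ j))\<^sup>2) = (1 :: complex)"
      by (simp only: complex_norm_square) (simp add: mult.commute)
    then have "(cmod (F $ j $ j))\<^sup>2 = 1"
      by (simp only: of_real_eq_1_iff)
    then have "cmod (F $ j $ j) = 1"
      by (simp add: power2_eq_1_iff) (metis norm_ge_zero not_one_le_zero neg_0_le_iff_le)
    moreover have "F $ j $ j = of_real (Re (R $ j $ j) / Re (R' $ j $ j))"
      using R_entry[of j] R'_pos R_pos by (metis nonzero_eq_divide_eq of_real_divide order_refl)
    ultimately have "F $ j $ j = 1"
      by (simp only: norm_of_real abs_of_pos[OF divide_pos_pos[OF R_pos(2) R'_pos(3)]] of_real_1)
    then show ?case using off by auto
  qed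
  then have "F = mat 1" by (simp add: vec_eq_iff mat_def)
  then show ?thesis using RF by simp
qed

section \<open>Cholesky and R factors of matrices close to the identity\<close>

text \<open>
  For Hermitian \<open>S\<close> this is the unique upper triangular matrix with real diagonal whose
  Hermitian double is \<open>S\<close>.
\<close>

definition upper_half :: "complex ^ 'n::{finite,linorder} ^ 'n::{finite,linorder}
    \<Rightarrow> complex ^ 'n::{finite,linorder} ^ 'n::{finite,linorder}" where
  "upper_half S = (\<chi> i j. if i < j then S $ i $ j else if i = j then S $ i $ i / 2 else 0)"

lemma upper_half_add_ctranspose:
  assumes "ctranspose S = S"
  shows "upper_half S + ctranspose (upper_half S) = S"
proof -
  have "cnj (S $ j $ i) = S $ i $ j" for i j
    using assms by (metis ctranspose_nth)
  then show ?thesis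
    by (auto simp: vec_eq_iff upper_half_def)
qed

text \<open>
  An off-diagonal pair of entries of \<open>S\<close> is represented by one entry of \<open>upper_half S\<close>, and a
  diagonal entry is halved; so the squared norm drops at least by the factor two.
\<close>

lemma norm_upper_half_le:
  fixes S :: "complex ^ 'n::{finite,linorder} ^ 'n::{finite,linorder}"
  assumes "ctranspose S = S"
  shows "sqrt 2 * norm (upper_half S) \<le> norm S"
proof -
  let ?P = "upper_half S"
  have "2 * (norm ?P)\<^sup>2 = (\<Sum>i\<in>UNIV. \<Sum>j\<in>UNIV. (cmod (?P $ i $ j))\<^sup>2)
      + (\<Sum>i\<in>UNIV. \<Sum>j\<in>UNIV. (cmod (ctranspose ?P $ i $ j))\<^sup>2)"
    unfolding norm_matrix_sq[symmetric] by simp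
  also have "\<dots> = (\<Sum>i\<in>UNIV. \<Sum>j\<in>UNIV. (cmod (?P $ i $ j))\<^sup>2 + (cmod (?P $ j $ i))\<^sup>2)"
    by (simp add: sum.distrib)
  also have "\<dots> \<le> (\<Sum>i\<in>UNIV. \<Sum>j\<in>UNIV. (cmod (S $ i $ j))\<^sup>2)"
  proof (intro sum_mono)
    fix i j
    have "cmod (S $ j $ i) = cmod (S $ i $ j)"
      using assms by (metis ctranspose_nth complex_mod_cnj)
    moreover have "0 \<le> (cmod (S $ j $ j))\<^sup>2" by simp
    ultimately show "(cmod (?P $ i $ j))\<^sup>2 + (cmod (?P $ j $ i))\<^sup>2 \<le> (cmod (S $ i $ j))\<^sup>2"
      by (auto simp: upper_half_def norm_divide power_divide)
  qed
  finally have "(sqrt 2 * norm ?P)\<^sup>2 \<le> (norm S)\<^sup>2"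
    by (simp add: norm_matrix_sq power_mult_distrib)
  then show ?thesis by (rule power2_le_imp_le) simp
qed

text \<open>
  For \<open>T = I + E\<close> with \<open>E\<close> upper triangular with real diagonal, \<open>T\<^sup>*T = I + N\<close> says
  \<open>E + E\<^sup>* = N - E\<^sup>*E\<close>, that is, \<open>E\<close> is a fixed point of
  \<open>E \<mapsto> upper_half (N - E\<^sup>*E)\<close>. The condition on \<open>r\<close> makes this map send the ball of radius
  \<open>r\<close> into itself, so Brouwer's theorem yields a fixed point that obeys the bound from the outset.
\<close>

lemma cholesky_near_identity:
  fixes N :: "complex ^ 'n::{finite,linorder} ^ 'n::{finite,linorder}"
  assumes N: "ctranspose N = N" and r: "0 \<le> r" "norm N + r\<^sup>2 \<le> sqrt 2 * r" "r < 1"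
  obtains T where "upper_triangular_matrix T" "positive_diagonal T"
    "ctranspose T ** T = mat 1 + N" "norm (T - mat 1) \<le> r"
proof -
  define f where "f E = upper_half (N - ctranspose E ** E)"
    for E :: "complex ^ 'n::{finite,linorder} ^ 'n::{finite,linorder}"
  have herm: "ctranspose (N - ctranspose E ** E) = N - ctranspose E ** E"
    for E :: "complex ^ 'n::{finite,linorder} ^ 'n::{finite,linorder}"
    using N by (simp add: ctranspose_diff ctranspose_mult)
  have self: "norm (f E) \<le> r" if "norm E \<le> r" for E
  proof -
    have "sqrt 2 * norm (f E) \<le> norm (N - ctranspose E ** E)"
      unfolding f_def by (rule norm_upper_half_le[OF herm])
    also have "\<dots> \<le> norm N + norm E * norm E"
      using norm_triangle_ineq4[of N "ctranspose E ** E"] frobenius_mult_le[of "ctranspose E" E] by simp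
    also have "\<dots> \<le> norm N + r * r"
      using that r(1) by (intro add_left_mono mult_mono) auto
    also have "\<dots> \<le> sqrt 2 * r" using r by (simp add: power2_eq_square)
    finally show ?thesis by simp
  qed
  have "\<exists>E. norm E \<le> r \<and> f E = E"
  proof (cases "r = 0")
    case True
    then have "f 0 = 0" using self[of 0] by simp
    then show ?thesis using True by auto
  next
    case False
    have entry: "continuous_on (cball 0 r)
        (\<lambda>E :: complex ^ 'n::{finite,linorder} ^ 'n::{finite,linorder}. (N - ctranspose E ** E) $ i $ j)" for i j
      by (simp add: matrix_matrix_mult_def) (intro continuous_intros)
    have "continuous_on (cball 0 r) (\<lambda>E :: complex ^ 'n::{finite,linorder} ^ 'n::{finite,linorder}.
        if i < j then (N - ctranspose E ** E) $ i $ j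
        else if i = j then (N - ctranspose E ** E) $ i $ i / 2 else 0)" for i j
      using entry[of i j] continuous_on_divide[OF entry[of i i] continuous_on_const[of _ 2]]
      by (cases "i < j"; cases "i = j") simp_all
    then have "continuous_on (cball 0 r) f"
      unfolding f_def upper_half_def by (intro continuous_on_vec_lambda)
    moreover have "f \<in> cball 0 r \<rightarrow> cball 0 r"
      using self by (auto simp: dist_norm)
    ultimately obtain E where "E \<in> cball 0 r" "f E = E"
      using brouwer_ball[of r 0 f] False r(1) by (metis order_le_less)
    then show ?thesis by (auto simp: dist_norm)
  qed
  then obtain E where E: "norm E \<le> r" "f E = E" by auto
  have "E $ i $ j = 0" if "j < i" for i j
    using that by (subst E(2)[symmetric]) (auto simp: f_def upper_half_def)
  then have upper: "upper_triangular_matrix E"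
    by (simp add: upper_triangular_matrix_def)
  have real: "E $ i $ i \<in> \<real>" for i
  proof -
    have "cnj ((N - ctranspose E ** E) $ i $ i) = (N - ctranspose E ** E) $ i $ i"
      using herm by (metis ctranspose_nth)
    then have "(N - ctranspose E ** E) $ i $ i / 2 \<in> \<real>"
      by (simp add: Reals_cnj_iff)
    then have "f E $ i $ i \<in> \<real>" by (simp add: f_def upper_half_def)
    then show ?thesis by (simp add: E(2))
  qed
  have "0 < Re ((mat 1 + E) $ i $ i)" for i
  proof -
    have "\<bar>Re (E $ i $ i)\<bar> \<le> norm E"
      using abs_Re_le_cmod[of "E $ i $ i"] Finite_Cartesian_Product.norm_nth_le[of "E $ i" i] Finite_Cartesian_Product.norm_nth_le[of E i] by linarith
    then show ?thesis using E(1) r(3) by (simp add: mat_def)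
  qed
  then have "positive_diagonal (mat 1 + E)"
    using real by (auto simp: positive_diagonal_def mat_def)
  moreover have "upper_triangular_matrix (mat 1 + E)"
    using upper by (auto simp: upper_triangular_matrix_def mat_def)
  moreover have "ctranspose (mat 1 + E) ** (mat 1 + E) = mat 1 + N"
  proof -
    have "E + ctranspose E = N - ctranspose E ** E"
      using upper_half_add_ctranspose[OF herm, of E] E(2) by (simp add: f_def)
    moreover have "ctranspose (mat 1 + E) ** (mat 1 + E)
        = mat 1 + (E + ctranspose E) + ctranspose E ** E"
      by (simp add: ctranspose_add matrix_add_ldistrib matrix_mult_add_left)
    ultimately show ?thesis by simp
  qed
  ultimately show ?thesis using E(1) by (intro that[of "mat 1 + E"]) auto
qed

text \<open>
  The R factor is the Cholesky factor of the Gram matrix. The unitary \<open>q\<close> conjugates that Gram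
  matrix and leaves its distance from the identity unchanged; it is there so that
  factorizations of the factors of a product can be chained.
\<close>

lemma QR_near_identity:
  fixes A q :: "complex ^ 'n::{finite,linorder} ^ 'n::{finite,linorder}"
  assumes q: "unitary_matrix q" and A: "norm A \<le> a"
    and r: "0 \<le> r" "2 * a + a\<^sup>2 + r\<^sup>2 \<le> sqrt 2 * r" "r < 1"
  obtains Q T where "is_QR ((mat 1 + A) ** q) Q T" "norm (T - mat 1) \<le> r"
proof -
  define B where "B = (mat 1 + A) ** q"
  define N where "N = ctranspose q ** (A + ctranspose A + ctranspose A ** A) ** q"
  have qq: "ctranspose q ** q = mat 1" using q by (simp add: unitary_matrix_def)
  have BN: "ctranspose B ** B = mat 1 + N"
  proof -
    have "ctranspose B ** B = ctranspose q ** (ctranspose (mat 1 + A) ** (mat 1 + A)) ** q"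
      by (simp add: B_def ctranspose_mult matrix_mul_assoc)
    also have "ctranspose (mat 1 + A) ** (mat 1 + A)
        = mat 1 + (A + ctranspose A + ctranspose A ** A)"
      by (simp add: ctranspose_add matrix_add_ldistrib matrix_mult_add_left)
    also have "ctranspose q ** (mat 1 + (A + ctranspose A + ctranspose A ** A)) ** q = mat 1 + N"
      by (simp only: matrix_add_ldistrib matrix_mult_add_left N_def matrix_mul_rid qq)
    finally show ?thesis .
  qed
  have "ctranspose N = N"
    by (simp add: N_def ctranspose_mult ctranspose_add matrix_mul_assoc add.commute)
  moreover have "norm N \<le> 2 * a + a\<^sup>2"
  proof -
    have "norm N = norm (A + ctranspose A + ctranspose A ** A)"
      using q by (simp add: N_def norm_unitary_mult_left norm_unitary_mult_right unitary_ctranspose)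
    also have "\<dots> \<le> norm A + norm A + norm A * norm A"
    proof -
      have "norm (ctranspose A ** A) \<le> norm A * norm A"
        using frobenius_mult_le[of "ctranspose A" A] by simp
      then show ?thesis
        using norm_triangle_ineq[of "A + ctranspose A" "ctranspose A ** A"]
          norm_triangle_ineq[of A "ctranspose A"] by simp
    qed
    also have "\<dots> \<le> a + a + a * a"
      using A order_trans[OF norm_ge_zero A] by (intro add_mono mult_mono) auto
    finally show ?thesis by (simp add: power2_eq_square)
  qed
  moreover from this have "norm N + r\<^sup>2 \<le> sqrt 2 * r" using r(2) by linarith
  ultimately obtain T where T: "upper_triangular_matrix T" "positive_diagonal T"
    "ctranspose T ** T = mat 1 + N" "norm (T - mat 1) \<le> r"
    using cholesky_near_identity[of N r] r(1,3) by metis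
  have "invertible T"
    using invertible_mat_1_plus[of "T - mat 1"] T(4) r(3) by simp
  note Ti = matrix_inv_mult[OF this]
  define Q where "Q = B ** matrix_inv T"
  have QT: "B = Q ** T"
    by (simp add: Q_def Ti flip: matrix_mul_assoc)
  have "ctranspose Q ** Q = ctranspose (matrix_inv T) ** (ctranspose B ** B) ** matrix_inv T"
    by (simp add: Q_def ctranspose_mult matrix_mul_assoc)
  also have "\<dots> = ctranspose (T ** matrix_inv T) ** (T ** matrix_inv T)"
    by (simp only: BN T(3)[symmetric] ctranspose_mult matrix_mul_assoc)
  finally have "ctranspose Q ** Q = mat 1" by (simp add: Ti)
  then have "unitary_matrix Q"
    by (simp add: unitary_matrix_def matrix_left_right_inverse)
  then show ?thesis
    using T QT by (intro that[of Q T]) (auto simp: is_QR_def B_def)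
qed

section \<open>Conjugation by a descending positive diagonal matrix\<close>

lemma diagonal_mult_left_nth:
  assumes "diagonal_matrix D"
  shows "(D ** A) $ i $ j = D $ i $ i * A $ i $ j"
proof -
  have "(\<Sum>k\<in>UNIV. D $ i $ k * A $ k $ j) = (\<Sum>k\<in>{i}. D $ i $ k * A $ k $ j)"
    using assms by (intro sum.mono_neutral_right) (auto simp: diagonal_matrix_def)
  then show ?thesis by (simp add: matrix_matrix_mult_def)
qed

lemma diagonal_mult_right_nth:
  assumes "diagonal_matrix D"
  shows "(A ** D) $ i $ j = A $ i $ j * D $ j $ j"
proof -
  have "(\<Sum>k\<in>UNIV. A $ i $ k * D $ k $ j) = (\<Sum>k\<in>{j}. A $ i $ k * D $ k $ j)"
    using assms by (intro sum.mono_neutral_right) (auto simp: diagonal_matrix_def)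
  then show ?thesis by (simp add: matrix_matrix_mult_def)
qed

lemma matrix_inv_unique:
  fixes A B :: "complex ^ 'n ^ 'n"
  assumes "A ** B = mat 1"
  shows "invertible A" "matrix_inv A = B"
proof -
  have "B ** A = mat 1" using assms by (simp add: matrix_left_right_inverse)
  then show inv: "invertible A" using assms by (auto simp: invertible_def)
  have "matrix_inv A = matrix_inv A ** (A ** B)" by (simp add: assms)
  also have "\<dots> = B" by (simp add: matrix_mul_assoc matrix_inv_mult[OF inv])
  finally show "matrix_inv A = B" .
qed

lemma diagonal_matrix_inv:
  fixes D :: "complex ^ 'n ^ 'n"
  assumes "diagonal_matrix D" "\<And>i. D $ i $ i \<noteq> 0"
  shows "invertible D" "matrix_inv D = (\<chi> i j. if i = j then inverse (D $ i $ i) else 0)"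
proof -
  have "D ** (\<chi> i j. if i = j then inverse (D $ i $ i) else 0) = mat 1"
    using assms(2) by (auto simp: vec_eq_iff diagonal_mult_left_nth[OF assms(1)] mat_def)
  from matrix_inv_unique[OF this] show "invertible D"
    "matrix_inv D = (\<chi> i j. if i = j then inverse (D $ i $ i) else 0)" by auto
qed

locale singular_values =
  fixes \<Sigma> :: "complex ^ 'n::{finite,linorder} ^ 'n::{finite,linorder}"
  assumes diagonal: "diagonal_matrix \<Sigma>"
    and positive: "positive_diagonal \<Sigma>"
    and descending: "descending_diagonal \<Sigma>"
begin

lemma entry_pos: "0 < Re (\<Sigma> $ i $ i)" and entry_real: "\<Sigma> $ i $ i = of_real (Re (\<Sigma> $ i $ i))"
  using positive by (auto simp: positive_diagonal_def complex_is_Real_iff complex_eq_iff)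

lemma entry_nonzero: "\<Sigma> $ i $ i \<noteq> 0"
  using entry_pos[of i] by auto

lemma cmod_entry: "cmod (\<Sigma> $ i $ i) = Re (\<Sigma> $ i $ i)"
  using entry_pos[of i] by (subst entry_real) simp

lemmas inv = diagonal_matrix_inv[OF diagonal entry_nonzero]
lemmas inv_mult [simp] = matrix_inv_mult[OF inv(1)]

lemma ctranspose_eq: "ctranspose \<Sigma> = \<Sigma>"
proof -
  have "cnj (\<Sigma> $ j $ i) = \<Sigma> $ i $ j" for i j
    using diagonal by (cases "i = j")
      (auto simp: diagonal_matrix_def complex_eq_iff intro: arg_cong[OF entry_real, of Im, simplified])
  then show ?thesis by (simp add: vec_eq_iff)
qed

lemma ctranspose_inv: "ctranspose (matrix_inv \<Sigma>) = matrix_inv \<Sigma>"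
proof -
  have "\<Sigma> ** ctranspose (matrix_inv \<Sigma>) = ctranspose (matrix_inv \<Sigma> ** \<Sigma>)"
    by (simp only: ctranspose_mult ctranspose_eq)
  then have "\<Sigma> ** ctranspose (matrix_inv \<Sigma>) = mat 1" by simp
  from matrix_inv_unique(2)[OF this] show ?thesis by simp
qed

lemma diagonal_inv: "diagonal_matrix (matrix_inv \<Sigma>)"
  by (simp add: diagonal_matrix_def inv(2))

lemma upper_triangular: "upper_triangular_matrix \<Sigma>"
  using diagonal by (auto simp: diagonal_matrix_def upper_triangular_matrix_def)

lemma conjugate_nth: "(matrix_inv \<Sigma> ** A ** \<Sigma>) $ i $ j = A $ i $ j * (\<Sigma> $ j $ j / \<Sigma> $ i $ i)"
  by (simp add: diagonal_mult_right_nth[OF diagonal] diagonal_mult_left_nth[OF diagonal_inv])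
    (simp add: inv(2) field_simps)

text \<open>
  Conjugation multiplies the \<open>(i, j)\<close> entry by \<open>\<sigma>\<^sub>j / \<sigma>\<^sub>i\<close>. Only entries with \<open>i \<le> j\<close> occur,
  and for those the factor is at most one.
\<close>

lemma norm_conjugate_minus_mat_1_le:
  assumes "upper_triangular_matrix T"
  shows "norm (matrix_inv \<Sigma> ** T ** \<Sigma> - mat 1) \<le> norm (T - mat 1)"
proof -
  have "matrix_inv \<Sigma> ** T ** \<Sigma> - mat 1 = matrix_inv \<Sigma> ** (T - mat 1) ** \<Sigma>"
    by (simp add: matrix_mult_diff_left matrix_mult_diff_right)
  also have "norm \<dots> \<le> norm (T - mat 1)"
  proof (rule norm_matrix_entrywise_mono)
    fix i j
    show "cmod ((matrix_inv \<Sigma> ** (T - mat 1) ** \<Sigma>) $ i $ j) \<le> cmod ((T - mat 1) $ i $ j)"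
    proof (cases "i \<le> j")
      case True
      then have "Re (\<Sigma> $ j $ j) \<le> Re (\<Sigma> $ i $ i)"
        using descending by (auto simp: descending_diagonal_def)
      then have "cmod (\<Sigma> $ j $ j / \<Sigma> $ i $ i) \<le> 1"
        using entry_pos[of i] by (simp add: norm_divide cmod_entry)
      then show ?thesis
        unfolding conjugate_nth norm_mult by (simp add: mult_left_le)
    next
      case False
      then have "(T - mat 1) $ i $ j = 0"
        using assms by (auto simp: upper_triangular_matrix_def mat_def)
      then show ?thesis unfolding conjugate_nth by simp
    qed
  qed
  finally show ?thesis .
qed

end

section \<open>The left-scaled R factor\<close>

text \<open>
  \<open>C = B(I + B)\<^sup>-\<^sup>1\<close> is the correction in \<open>I + 2B = (I + C)(I + B)\<close>; it is bounded by means of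
  \<open>C = B - CB\<close>.
\<close>

lemma norm_mult_inv_mat_1_plus_le:
  fixes B :: "complex ^ 'n ^ 'n"
  assumes B: "norm B \<le> b" "b < 1"
  obtains C where "C ** (mat 1 + B) = B" "norm C \<le> b / (1 - b)"
proof -
  have "invertible (mat 1 + B)" using assms by (intro invertible_mat_1_plus) simp
  note inv = matrix_inv_mult[OF this]
  define C where "C = B ** matrix_inv (mat 1 + B)"
  have C: "C ** (mat 1 + B) = B" by (simp add: C_def inv flip: matrix_mul_assoc)
  then have "C = B - C ** B" by (simp add: matrix_add_ldistrib eq_diff_eq)
  then have "norm C \<le> norm B + norm (C ** B)" by (metis norm_triangle_ineq4)
  also have "\<dots> \<le> b + norm C * b"
    using B(1) frobenius_mult_le[of C B] mult_left_mono[OF B(1) norm_ge_zero[of C]] by linarith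
  finally have "norm C \<le> b / (1 - b)" using B(2) by (simp add: field_simps)
  then show ?thesis using C that by blast
qed

text \<open>
  The numerical part of \<open>R_factor_left_scaled_perturbation\<close>. The bound \<open>9/40\<close> is slightly above
  \<open>sqrt (3/2) - 1\<close>. The numbers \<open>\<rho>\<close>, \<open>\<alpha>\<close> and \<open>\<beta>\<close> bound, respectively, the deviation from \<open>I\<close>
  of the Cholesky factor of \<open>W\<close>, of the product of that factor (suitably conjugated) with
  \<open>I + M/2\<close>, and of the second factor of \<open>I + M\<close>. The multipliers \<open>5/6\<close>, \<open>11/5\<close> and \<open>9/5\<close> are
  chosen so that the radius conditions of \<open>cholesky_near_identity\<close> and \<open>QR_near_identity\<close> hold
  throughout the range.
\<close>

lemma perturbation_arithmetic:
  fixes e h :: real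
  assumes "0 \<le> e" "0 \<le> h" "e + h \<le> 9/40"
  defines "\<rho> \<equiv> 5 / 6 * e"
  defines "\<alpha> \<equiv> \<rho> + h / 2 + \<rho> * (h / 2)" and "\<beta> \<equiv> (h / 2) / (1 - h / 2)"
  shows "e + \<rho>\<^sup>2 \<le> sqrt 2 * \<rho>" "\<rho> < 1"
    and "0 \<le> \<alpha>" "2 * \<alpha> + \<alpha>\<^sup>2 + (11/5 * \<alpha>)\<^sup>2 \<le> sqrt 2 * (11/5 * \<alpha>)" "11/5 * \<alpha> < 1"
    and "0 \<le> \<beta>" "2 * \<beta> + \<beta>\<^sup>2 + (9/5 * \<beta>)\<^sup>2 \<le> sqrt 2 * (9/5 * \<beta>)" "9/5 * \<beta> < 1"
    and "(1 + 9/5 * \<beta>) * ((1 + 11/5 * \<alpha>) * (1 + \<rho>)) - 1 \<le> 15/4 * e + 12/5 * h"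
proof -
  have sqrt2: "1.4142 \<le> sqrt 2" by (rule real_le_rsqrt) (simp add: power2_eq_square)
  have eeh: "e * e + e * h \<le> 9/40 * e" "e * h + h * h \<le> 9/40 * h"
    using mult_left_mono[OF assms(3) assms(1)] mult_left_mono[OF assms(3) assms(2)]
    by (simp_all add: algebra_simps)
  moreover have "0 \<le> e * e" "0 \<le> e * h" "0 \<le> h * h" using assms(1,2) by auto
  ultimately have e2: "e * e \<le> 9/40 * e" and eh: "e * h \<le> 9/40 * h" "e * h \<le> 9/40 * e"
    by linarith+
  have \<rho>: "\<rho> \<ge> 0" using assms by (simp add: \<rho>_def)
  have "e + \<rho>\<^sup>2 \<le> 1.4142 * \<rho>"
    using e2 assms(1) unfolding \<rho>_def power2_eq_square by (simp add: algebra_simps)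
  also have "\<dots> \<le> sqrt 2 * \<rho>" using sqrt2 \<rho> by (intro mult_right_mono)
  finally show "e + \<rho>\<^sup>2 \<le> sqrt 2 * \<rho>" .
  show "\<rho> < 1" using assms by (simp add: \<rho>_def)
  show \<alpha>0: "0 \<le> \<alpha>" using \<rho> assms(2) by (simp add: \<alpha>_def)
  have \<alpha>_eq: "\<alpha> = 5/6 * e + h / 2 + 5/12 * (e * h)" by (simp add: \<alpha>_def \<rho>_def)
  have \<alpha>: "\<alpha> \<le> 0.19" using eh assms by (simp add: \<alpha>_eq)
  then show "11/5 * \<alpha> < 1" by simp
  have "2 * \<alpha> + \<alpha>\<^sup>2 + (11/5 * \<alpha>)\<^sup>2 = \<alpha> * (2 + 146/25 * \<alpha>)"
    by (simp add: power2_eq_square algebra_simps)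
  also have "\<dots> \<le> \<alpha> * (11/5 * sqrt 2)"
    using \<alpha> \<alpha>0 sqrt2 by (intro mult_left_mono) auto
  finally show "2 * \<alpha> + \<alpha>\<^sup>2 + (11/5 * \<alpha>)\<^sup>2 \<le> sqrt 2 * (11/5 * \<alpha>)" by (simp add: mult_ac)
  have h: "h \<le> 9/40" using assms by simp
  have \<beta>: "\<beta> \<le> 0.5634 * h"
  proof -
    have "h / 2 \<le> 0.5634 * h * (1 - h / 2)"
      using mult_left_mono[OF h assms(2)] assms(2) by (simp add: algebra_simps)
    then show ?thesis unfolding \<beta>_def using h by (subst pos_divide_le_eq) auto
  qed
  show \<beta>0: "0 \<le> \<beta>" using assms(2) h by (simp add: \<beta>_def)
  have \<beta>': "\<beta> \<le> 0.127" using \<beta> h by simp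
  then show "9/5 * \<beta> < 1" by simp
  have "2 * \<beta> + \<beta>\<^sup>2 + (9/5 * \<beta>)\<^sup>2 = \<beta> * (2 + 106/25 * \<beta>)"
    by (simp add: power2_eq_square algebra_simps)
  also have "\<dots> \<le> \<beta> * (9/5 * sqrt 2)"
    using \<beta>' \<beta>0 sqrt2 by (intro mult_left_mono) auto
  finally show "2 * \<beta> + \<beta>\<^sup>2 + (9/5 * \<beta>)\<^sup>2 \<le> sqrt 2 * (9/5 * \<beta>)" by (simp add: mult_ac)
  have "11/5 * \<alpha> \<le> 2.04 * e + 1.1 * h" using eh(2) assms(1) by (simp add: \<alpha>_eq)
  then have "(1 + 11/5 * \<alpha>) * (1 + \<rho>) \<le> (1 + (2.04 * e + 1.1 * h)) * (1 + 5/6 * e)"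
    using assms(1) unfolding \<rho>_def by (intro mult_right_mono) auto
  also have "\<dots> = 1 + 2.04 * e + 1.1 * h + 5/6 * e + 1.7 * (e * e) + 1.1 * 5/6 * (e * h)"
    by (simp add: field_simps)
  also have "\<dots> \<le> 1 + 3.256 * e + 1.1 * h"
    using eeh(1) mult_nonneg_nonneg[OF assms(1) assms(2)] assms(1) by simp
  finally have "(1 + 9/5 * \<beta>) * ((1 + 11/5 * \<alpha>) * (1 + \<rho>))
      \<le> (1 + 1.015 * h) * (1 + 3.256 * e + 1.1 * h)"
    using \<beta> \<beta>0 \<alpha>0 \<rho> assms(2) by (intro mult_mono) auto
  also have "\<dots> = 1 + 3.256 * e + 2.115 * h + 1.1165 * (e * h + h * h) + 2.18834 * (e * h)"
    by (simp add: field_simps)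
  also have "\<dots> \<le> 1 + 15/4 * e + 12/5 * h"
  proof -
    have "1 + 3.256 * e + 2.115 * h + 1.1165 * s + 2.18834 * p \<le> 1 + 15/4 * e + 12/5 * h"
      if "s \<le> 9/40 * h" "p \<le> 9/40 * e" for s p :: real
      using that assms(1,2) by simp
    then show ?thesis using eeh(2) eh(2) .
  qed
  finally show "(1 + 9/5 * \<beta>) * ((1 + 11/5 * \<alpha>) * (1 + \<rho>)) - 1 \<le> 15/4 * e + 12/5 * h" by simp
qed

text \<open>
  With \<open>W = C\<^sup>*C\<close> and \<open>L = \<Sigma>C\<^sup>*\<Sigma>\<^sup>-\<^sup>1\<close> the factored matrix is \<open>V(I + M)L\<Sigma>C\<close>, where \<open>M\<close>, \<open>L - I\<close>
  and \<open>C - I\<close> are small irrespective of the condition number of \<open>\<Sigma>\<close>. The factor \<open>I + M\<close> is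
  written as \<open>(I + F)(I + M/2)\<close>, and the triangular factors \<open>T\<^sub>1\<close> of \<open>(I + M/2)L\<close> and \<open>T\<^sub>2\<close> of
  \<open>I + F\<close> (after the unitary factor of the first) give \<open>R = T\<^sub>2T\<^sub>1\<Sigma>C\<close>. The scaling then acts on
  \<open>T\<^sub>1\<close> and \<open>T\<^sub>2\<close> only by conjugation.
\<close>

lemma (in singular_values) R_factor_left_scaled_perturbation:
  fixes W M :: "complex ^ 'n::{finite,linorder} ^ 'n::{finite,linorder}"
  assumes W: "ctranspose W = W" "norm (W - mat 1) \<le> e"
    and M: "norm M \<le> h" and small: "e + h \<le> 9/40"
    and QR: "is_QR (V ** (mat 1 + M) ** \<Sigma> ** W) Q R" and V: "unitary_matrix V"
  shows "norm (matrix_inv \<Sigma> ** R - mat 1) \<le> 15/4 * e + 12/5 * h"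
proof -
  have e: "0 \<le> e" and h: "0 \<le> h" using W(2) M norm_ge_zero order_trans by blast+
  define \<rho> where "\<rho> = 5 / 6 * e"
  define \<alpha> where "\<alpha> = \<rho> + h / 2 + \<rho> * (h / 2)"
  define \<beta> where "\<beta> = (h / 2) / (1 - h / 2)"
  note arith = perturbation_arithmetic[OF e h small, folded \<rho>_def, folded \<alpha>_def \<beta>_def]
  have "ctranspose (W - mat 1) = W - mat 1" using W(1) by (simp add: ctranspose_diff)
  moreover have "norm (W - mat 1) + \<rho>\<^sup>2 \<le> sqrt 2 * \<rho>" using W(2) arith(1) by linarith
  ultimately obtain C where C: "upper_triangular_matrix C" "positive_diagonal C"
    "ctranspose C ** C = W" "norm (C - mat 1) \<le> \<rho>"
    using cholesky_near_identity[of "W - mat 1" \<rho>] arith(2) e by (auto simp: \<rho>_def)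
  define B where "B = (1/2) *\<^sub>R M"
  have B: "norm B \<le> h / 2" using M by (simp add: B_def)
  obtain F where F: "F ** (mat 1 + B) = B" "norm F \<le> \<beta>"
    using norm_mult_inv_mat_1_plus_le[OF B] small h e by (auto simp: \<beta>_def)
  have split: "mat 1 + M = (mat 1 + F) ** (mat 1 + B)"
  proof -
    have "M = B + B" by (simp add: B_def scaleR_add_left[symmetric])
    moreover have "(mat 1 + F) ** (mat 1 + B) = mat 1 + B + F ** (mat 1 + B)"
      by (simp only: matrix_mult_add_left matrix_mul_lid)
    ultimately show ?thesis by (simp only: F(1) add.assoc)
  qed
  \<comment> \<open>As the adjoint of a conjugated upper triangular matrix, \<open>L\<close> deviates from \<open>I\<close> no more than \<open>C\<close>.\<close>
  define L where "L = ctranspose (matrix_inv \<Sigma> ** C ** \<Sigma>)"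
  have L: "L = \<Sigma> ** ctranspose C ** matrix_inv \<Sigma>"
    by (simp add: L_def ctranspose_mult ctranspose_eq ctranspose_inv matrix_mul_assoc)
  have "norm (L - mat 1) = norm (ctranspose (L - mat 1))" by simp
  also have "\<dots> = norm (matrix_inv \<Sigma> ** C ** \<Sigma> - mat 1)"
    by (simp only: ctranspose_diff L_def ctranspose_ctranspose ctranspose_mat_1)
  finally have norm_L: "norm (L - mat 1) \<le> \<rho>"
    using norm_conjugate_minus_mat_1_le[OF C(1)] C(4) by linarith
  define A where "A = (mat 1 + B) ** L - mat 1"
  have "norm A \<le> (1 + h / 2) * (1 + \<rho>) - 1"
    unfolding A_def by (rule norm_mult_minus_mat_1_le) (use B norm_L in auto)
  then have "norm A \<le> \<alpha>" by (simp add: \<alpha>_def field_simps)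
  have "unitary_matrix (mat 1 :: complex ^ 'n::{finite,linorder} ^ 'n::{finite,linorder})"
    by (simp add: unitary_matrix_def)
  moreover have "0 \<le> 11/5 * \<alpha>" "0 \<le> 9/5 * \<beta>" using arith(3,6) by simp_all
  ultimately obtain Q\<^sub>1 T\<^sub>1 where 1: "is_QR ((mat 1 + A) ** mat 1) Q\<^sub>1 T\<^sub>1" "norm (T\<^sub>1 - mat 1) \<le> 11/5 * \<alpha>"
    using QR_near_identity[OF _ \<open>norm A \<le> \<alpha>\<close> _ arith(4,5)] by metis
  then have AQT: "(mat 1 + B) ** L = Q\<^sub>1 ** T\<^sub>1" and Q\<^sub>1: "unitary_matrix Q\<^sub>1"
    and T\<^sub>1: "upper_triangular_matrix T\<^sub>1" "positive_diagonal T\<^sub>1"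
    by (simp_all add: is_QR_def A_def)
  obtain Q\<^sub>2 T\<^sub>2 where 2: "is_QR ((mat 1 + F) ** Q\<^sub>1) Q\<^sub>2 T\<^sub>2" "norm (T\<^sub>2 - mat 1) \<le> 9/5 * \<beta>"
    using QR_near_identity[OF Q\<^sub>1 F(2) \<open>0 \<le> 9/5 * \<beta>\<close> arith(7,8)] by metis
  then have FQT: "(mat 1 + F) ** Q\<^sub>1 = Q\<^sub>2 ** T\<^sub>2" and Q\<^sub>2: "unitary_matrix Q\<^sub>2"
    and T\<^sub>2: "upper_triangular_matrix T\<^sub>2" "positive_diagonal T\<^sub>2"
    by (simp_all add: is_QR_def)
  have "V ** (mat 1 + M) ** \<Sigma> ** W = V ** (mat 1 + F) ** ((mat 1 + B) ** L) ** \<Sigma> ** C"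
  proof -
    have "L ** \<Sigma> ** C = \<Sigma> ** ctranspose C ** (matrix_inv \<Sigma> ** \<Sigma>) ** C"
      unfolding L by (simp only: matrix_mul_assoc)
    also have "\<dots> = \<Sigma> ** W" by (simp add: C(3) flip: matrix_mul_assoc)
    finally show ?thesis unfolding split by (simp flip: matrix_mul_assoc)
  qed
  also have "\<dots> = V ** ((mat 1 + F) ** Q\<^sub>1) ** T\<^sub>1 ** \<Sigma> ** C"
    by (simp only: AQT matrix_mul_assoc)
  also have "\<dots> = (V ** Q\<^sub>2) ** (T\<^sub>2 ** T\<^sub>1 ** \<Sigma> ** C)"
    by (simp only: FQT matrix_mul_assoc)
  finally have "is_QR (V ** (mat 1 + M) ** \<Sigma> ** W) (V ** Q\<^sub>2) (T\<^sub>2 ** T\<^sub>1 ** \<Sigma> ** C)"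
    using V Q\<^sub>2 T\<^sub>1 T\<^sub>2 C(1,2) upper_triangular positive unfolding is_QR_def
    by (intro conjI unitary_mult positive_diagonal_mult upper_triangular_mult) auto
  then have R: "R = T\<^sub>2 ** T\<^sub>1 ** \<Sigma> ** C" using QR_unique QR by blast
  have "matrix_inv \<Sigma> ** R = (matrix_inv \<Sigma> ** T\<^sub>2 ** (\<Sigma> ** matrix_inv \<Sigma>) ** T\<^sub>1 ** \<Sigma>) ** C"
    by (simp add: R matrix_mul_assoc)
  also have "\<dots> = (matrix_inv \<Sigma> ** T\<^sub>2 ** \<Sigma>) ** ((matrix_inv \<Sigma> ** T\<^sub>1 ** \<Sigma>) ** C)"
    by (simp only: matrix_mul_assoc)
  finally have "norm (matrix_inv \<Sigma> ** R - mat 1)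
      = norm ((matrix_inv \<Sigma> ** T\<^sub>2 ** \<Sigma>) ** ((matrix_inv \<Sigma> ** T\<^sub>1 ** \<Sigma>) ** C) - mat 1)" by simp
  also have "\<dots> \<le> (1 + 9/5 * \<beta>) * (1 + ((1 + 11/5 * \<alpha>) * (1 + \<rho>) - 1)) - 1"
    using norm_conjugate_minus_mat_1_le[OF T\<^sub>1(1)] norm_conjugate_minus_mat_1_le[OF T\<^sub>2(1)] 1(2) 2(2)
    by (intro norm_mult_minus_mat_1_le[OF _ norm_mult_minus_mat_1_le[OF _ C(4)]]) linarith+
  also have "\<dots> \<le> 15/4 * e + 12/5 * h" using arith(9) by simp
  finally show ?thesis .
qed

section \<open>Norm estimates for the computed factors\<close>

text \<open>
  If \<open>U\<^sup>*U\<close> differs from \<open>I\<close> by at most \<open>e\<close>, then \<open>(1 - e)\<parallel>x\<parallel>\<^sup>2 \<le> \<parallel>Ux\<parallel>\<^sup>2\<close>. This bounds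
  \<open>U\<^sup>-\<^sup>1\<close> by \<open>1 / sqrt (1 - e)\<close>, which is at most \<open>1 + e\<close> in the range considered.
\<close>

lemma spectral_norm_inv_near_isometry:
  fixes U :: "complex ^ 'n ^ 'n"
  assumes U: "norm (ctranspose U ** U - mat 1) \<le> e" and e: "e \<le> 1 / 2"
  shows "invertible U" "spectral_norm (matrix_inv U) \<le> 1 + e"
proof -
  have "0 \<le> e" using U norm_ge_zero order_trans by blast
  have "invertible (ctranspose U ** U)"
    using invertible_mat_1_plus[of "ctranspose U ** U - mat 1"] U e by simp
  from matrix_inv_mult(2)[OF this] have "(matrix_inv (ctranspose U ** U) ** ctranspose U) ** U = mat 1"
    by (simp only: matrix_mul_assoc)
  then show "invertible U" unfolding invertible_left_inverse by (rule exI)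
  note inv = matrix_inv_mult[OF this]
  have below: "norm x \<le> (1 + e) * norm (U *v x)" for x
  proof -
    have "x \<bullet> ((ctranspose U ** U - mat 1) *v x) = (norm (U *v x))\<^sup>2 - (norm x)\<^sup>2"
      by (simp add: power2_norm_eq_inner inner_ctranspose matrix_vector_mul_assoc inner_diff_right
          matrix_vector_mult_diff_rdistrib)
    moreover have "\<bar>x \<bullet> ((ctranspose U ** U - mat 1) *v x)\<bar> \<le> norm x * (e * norm x)"
    proof -
      have "spectral_norm (ctranspose U ** U - mat 1) * norm x \<le> e * norm x"
        using U spectral_norm_le_frobenius[of "ctranspose U ** U - mat 1"]
        by (intro mult_right_mono) auto
      then have "norm ((ctranspose U ** U - mat 1) *v x) \<le> e * norm x"
        using norm_matrix_vector_le[of "ctranspose U ** U - mat 1" x] by linarith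
      then show ?thesis
        using Cauchy_Schwarz_ineq2[of x "(ctranspose U ** U - mat 1) *v x"]
          mult_left_mono[OF _ norm_ge_zero[of x], of "norm ((ctranspose U ** U - mat 1) *v x)" "e * norm x"]
        by simp
    qed
    ultimately have *: "(1 - e) * (norm x)\<^sup>2 \<le> (norm (U *v x))\<^sup>2"
      by (simp only: power2_eq_square abs_le_iff left_diff_distrib) (simp add: mult_ac)
    have "0 \<le> e * (1 - e - e * e)"
      using \<open>0 \<le> e\<close> e mult_mono[OF e e] by (intro mult_nonneg_nonneg) auto
    then have "1 \<le> (1 + e)\<^sup>2 * (1 - e)"
      by (simp add: power2_eq_square algebra_simps)
    then have "(norm x)\<^sup>2 \<le> ((1 + e)\<^sup>2 * (1 - e)) * (norm x)\<^sup>2"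
      using mult_right_mono[of 1 "(1 + e)\<^sup>2 * (1 - e)" "(norm x)\<^sup>2"] by simp
    also have "\<dots> \<le> (1 + e)\<^sup>2 * (norm (U *v x))\<^sup>2"
      using mult_left_mono[OF *, of "(1 + e)\<^sup>2"] by (simp add: mult.assoc)
    finally have "(norm x)\<^sup>2 \<le> ((1 + e) * norm (U *v x))\<^sup>2" by (simp add: power_mult_distrib)
    then show ?thesis by (rule power2_le_imp_le) (use \<open>0 \<le> e\<close> in auto)
  qed
  show "spectral_norm (matrix_inv U) \<le> 1 + e"
  proof (rule spectral_norm_leI)
    fix y
    show "norm (matrix_inv U *v y) \<le> (1 + e) * norm y"
      using below[of "matrix_inv U *v y"] by (simp add: matrix_vector_mul_assoc inv)
  qed (use \<open>0 \<le> e\<close> in simp)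
qed

lemma frobenius_le_of_rows:
  fixes A :: "complex ^ 'n ^ 'm"
  assumes "\<And>i. norm (row i A) \<le> c" "0 \<le> c"
  shows "norm A \<le> sqrt (real CARD('m)) * c"
proof (rule power2_le_imp_le)
  have "(norm A)\<^sup>2 \<le> (\<Sum>i\<in>(UNIV :: 'm set). c\<^sup>2)"
    unfolding norm_sq_rows using assms by (intro sum_mono power_mono) auto
  then show "(norm A)\<^sup>2 \<le> (sqrt (real CARD('m)) * c)\<^sup>2"
    by (simp add: power_mult_distrib)
qed (use assms in simp)

lemma norm_row_diagonal_mult:
  fixes A D :: "complex ^ 'n ^ 'n"
  assumes "diagonal_matrix D"
  shows "norm (row i (D ** A)) = cmod (D $ i $ i) * norm (row i A)"
proof -
  have "row i (D ** A) = D $ i $ i *s row i A"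
    by (simp add: vec_eq_iff row_def diagonal_mult_left_nth[OF assms])
  moreover have "norm (c *s x) = cmod c * norm x" for c and x :: "complex ^ 'n"
  proof (rule power2_eq_imp_eq)
    show "(norm (c *s x))\<^sup>2 = (cmod c * norm x)\<^sup>2"
      by (simp add: norm_vector_sq norm_mult power_mult_distrib sum_distrib_left)
  qed auto
  ultimately show ?thesis by simp
qed

text \<open>
  Dividing the \<open>i\<close>-th row by \<open>D\<^sub>i\<^sub>i\<close>, whose modulus is the norm of the \<open>i\<close>-th row of \<open>X\<close>, turns the
  rowwise relative bound into an absolute one; \<open>K = Z\<^sup>-\<^sup>1(D\<^sup>-\<^sup>1E)\<close> is then bounded without
  reference to the row scaling of \<open>X\<close>.
\<close>

lemma row_scaled_perturbation:
  fixes X Z D E :: "complex ^ 'n ^ 'n"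
  assumes X: "X = D ** Z" "invertible X" and D: "diagonal_matrix D" and Z: "\<And>i. norm (row i Z) = 1"
    and E: "\<And>i. norm (row i E) \<le> \<epsilon> * norm (row i X)" and \<epsilon>: "0 \<le> \<epsilon>"
  obtains K where "E = X ** K"
    "norm K \<le> sqrt (real CARD('n)) * \<epsilon> * spectral_norm (matrix_inv Z)"
proof -
  note X_inv = matrix_inv_mult[OF X(2)]
  have DZ: "D ** (Z ** matrix_inv X) = mat 1" and "(matrix_inv X ** D) ** Z = mat 1"
    using X_inv unfolding X(1) by (simp_all add: matrix_mul_assoc)
  then have "invertible Z" by (metis invertible_left_inverse)
  note Z_inv = matrix_inv_mult[OF this]
  have D0: "D $ i $ i \<noteq> 0" for i
  proof
    assume "D $ i $ i = 0"
    then have "(D ** (Z ** matrix_inv X)) $ i $ i = 0" by (simp add: diagonal_mult_left_nth[OF D])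
    then show False by (simp add: DZ mat_def)
  qed
  note D_inv = diagonal_matrix_inv[OF D D0]
  have D_inv_diag: "diagonal_matrix (matrix_inv D)" by (simp add: diagonal_matrix_def D_inv(2))
  have "norm (row i (matrix_inv D ** E)) \<le> \<epsilon>" for i
  proof -
    have "norm (row i (matrix_inv D ** E)) = norm (row i E) / cmod (D $ i $ i)"
      by (simp add: norm_row_diagonal_mult[OF D_inv_diag]) (simp add: D_inv(2) norm_inverse divide_inverse mult.commute)
    then show ?thesis
      using E[of i] D0[of i] Z[of i]
      by (simp add: X(1) norm_row_diagonal_mult[OF D] pos_divide_le_eq)
  qed
  then have "norm (matrix_inv D ** E) \<le> sqrt (real CARD('n)) * \<epsilon>"
    using \<epsilon> by (rule frobenius_le_of_rows)
  then have "spectral_norm (matrix_inv Z) * norm (matrix_inv D ** E)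
      \<le> spectral_norm (matrix_inv Z) * (sqrt (real CARD('n)) * \<epsilon>)"
    by (intro mult_left_mono spectral_norm_nonneg)
  then have "norm (matrix_inv Z ** (matrix_inv D ** E))
      \<le> spectral_norm (matrix_inv Z) * (sqrt (real CARD('n)) * \<epsilon>)"
    using frobenius_mult_le_spectral_left order_trans by blast
  moreover have "E = X ** (matrix_inv Z ** (matrix_inv D ** E))"
  proof -
    have "X ** (matrix_inv Z ** (matrix_inv D ** E)) = D ** (Z ** matrix_inv Z) ** matrix_inv D ** E"
      by (simp only: X(1) matrix_mul_assoc)
    then show ?thesis by (simp add: Z_inv matrix_inv_mult(1)[OF D_inv(1)])
  qed
  ultimately show ?thesis using that by (simp add: mult_ac)
qed

section \<open>Accuracy of the left singular vectors\<close>

theorem theorem4: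
  fixes X U \<Sigma> V \<Delta>X Q\<^sub>1 R\<^sub>1 Y\<^sub>1 Y\<^sub>2 D Z :: "complex ^ 'n::{finite,linorder} ^ 'n::{finite,linorder}"
    and u u_low :: real
    and eps_SVD eps_U eps_qr :: "nat \<Rightarrow> real \<Rightarrow> real"
    and n :: nat and \<epsilon>SVD \<epsilon>U \<epsilon>qr \<gamma> :: real
  assumes n_def: "n = CARD('n)"
    and \<epsilon>SVD_def: "\<epsilon>SVD = eps_SVD n u_low"
    and \<epsilon>U_def: "\<epsilon>U = eps_U n u_low"
    and \<epsilon>qr_def: "\<epsilon>qr = eps_qr n u"
    and \<gamma>_def: "\<gamma> = roundoff_gamma n u"
    and roundoff: "0 < u" "u \<le> u_low" "real n * u < 1"
    and eps_nonneg: "0 \<le> \<epsilon>SVD" "0 \<le> \<epsilon>U" "0 \<le> \<epsilon>qr"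
    and V: "unitary_matrix V"
    and \<Sigma>: "diagonal_matrix \<Sigma>" "positive_diagonal \<Sigma>" "descending_diagonal \<Sigma>"
    and X: "X = U ** \<Sigma> ** ctranspose V + \<Delta>X"
    and \<Delta>X: "\<And>i. norm (row i \<Delta>X) \<le> \<epsilon>SVD * norm (row i X)"
    and U: "norm (ctranspose U ** U - mat 1) \<le> \<epsilon>U"
    and small: "\<epsilon>U * spectral_norm \<Sigma> * spectral_norm (matrix_inv \<Sigma>)
        + sqrt n * (\<epsilon>SVD + sqrt n * \<gamma> + \<epsilon>qr + sqrt n * \<gamma> * \<epsilon>qr) * (1 + \<epsilon>U)
            * spectral_norm X * spectral_norm (matrix_inv \<Sigma>)
        < sqrt (3 / 2) - 1"
    and QR: "is_QR (ctranspose X ** U) Q\<^sub>1 R\<^sub>1"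
    and Y\<^sub>1: "Y\<^sub>1 = X ** Q\<^sub>1"
    and Y\<^sub>2: "Y\<^sub>2 = X ** V"
    and DZ: "X = D ** Z" "diagonal_matrix D" "\<And>i. norm (row i Z) = 1"
  shows "spectral_norm (Y\<^sub>1 ** matrix_inv \<Sigma> - U)
           \<le> \<epsilon>U + (1 + \<epsilon>U) * (\<epsilon>U + (sqrt 2 + sqrt 3)
                * (\<epsilon>U + sqrt n * \<epsilon>SVD * spectral_norm (matrix_inv Z)))
       \<and> spectral_norm (Y\<^sub>2 ** matrix_inv \<Sigma> - U)
           \<le> n * \<epsilon>SVD * spectral_norm X * spectral_norm (matrix_inv \<Sigma>)"
proof -
  interpret singular_values \<Sigma> using \<Sigma> by unfold_locales
  let ?\<Sigma>i = "matrix_inv \<Sigma>"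
  define W where "W = ctranspose U ** U"
  define h where "h = sqrt n * \<epsilon>SVD * spectral_norm X * ((1 + \<epsilon>U) * spectral_norm ?\<Sigma>i)"
  define \<eta> where "\<eta> = sqrt n * \<epsilon>SVD * spectral_norm (matrix_inv Z)"
  have VV: "ctranspose V ** V = mat 1" "V ** ctranspose V = mat 1"
    using V by (auto simp: unitary_matrix_def)

  \<comment> \<open>The condition number of \<open>\<Sigma>\<close> is at least one, so the smallness hypothesis bounds \<open>\<epsilon>U + h\<close>.\<close>
  have "1 \<le> spectral_norm \<Sigma> * spectral_norm ?\<Sigma>i"
  proof -
    have "norm (axis undefined 1 :: complex ^ 'n::{finite,linorder})
        \<le> spectral_norm (\<Sigma> ** ?\<Sigma>i) * norm (axis undefined 1 :: complex ^ 'n::{finite,linorder})"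
      using norm_matrix_vector_le[of "\<Sigma> ** ?\<Sigma>i" "axis undefined 1"] by simp
    then show ?thesis
      using spectral_norm_mult_le[of \<Sigma> ?\<Sigma>i] by (simp add: norm_axis_1)
  qed
  then have "\<epsilon>U \<le> \<epsilon>U * spectral_norm \<Sigma> * spectral_norm ?\<Sigma>i"
    using mult_left_mono[OF _ eps_nonneg(2)] by (fastforce simp: mult.assoc)
  moreover have "h \<le> sqrt n * (\<epsilon>SVD + sqrt n * \<gamma> + \<epsilon>qr + sqrt n * \<gamma> * \<epsilon>qr) * (1 + \<epsilon>U)
      * spectral_norm X * spectral_norm ?\<Sigma>i"
  proof -
    have "0 \<le> \<gamma>" using roundoff by (simp add: \<gamma>_def roundoff_gamma_def)
    then have "\<epsilon>SVD \<le> \<epsilon>SVD + sqrt n * \<gamma> + \<epsilon>qr + sqrt n * \<gamma> * \<epsilon>qr"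
      using eps_nonneg by simp
    then have "sqrt n * \<epsilon>SVD * ((1 + \<epsilon>U) * spectral_norm X * spectral_norm ?\<Sigma>i)
        \<le> sqrt n * (\<epsilon>SVD + sqrt n * \<gamma> + \<epsilon>qr + sqrt n * \<gamma> * \<epsilon>qr)
          * ((1 + \<epsilon>U) * spectral_norm X * spectral_norm ?\<Sigma>i)"
      using eps_nonneg by (intro mult_right_mono mult_left_mono mult_nonneg_nonneg) auto
    then show ?thesis by (simp add: h_def mult_ac)
  qed
  moreover have "sqrt (3 / 2) \<le> 49/40"
    by (rule real_le_lsqrt) (simp_all add: power2_eq_square)
  ultimately have eh: "\<epsilon>U + h \<le> 9/40" using small by linarith
  have h0: "0 \<le> h" unfolding h_def using eps_nonneg by (intro mult_nonneg_nonneg) auto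
  have e: "\<epsilon>U \<le> 9/40" using eh h0 by simp

  have \<Delta>X_norm: "norm \<Delta>X \<le> sqrt n * \<epsilon>SVD * spectral_norm X"
  proof -
    have "norm (row i \<Delta>X) \<le> \<epsilon>SVD * spectral_norm X" for i
      using \<Delta>X[of i] mult_left_mono[OF norm_row_le_spectral_norm[of i X] eps_nonneg(1)] by linarith
    from frobenius_le_of_rows[OF this] show ?thesis using eps_nonneg by (simp add: n_def mult.assoc)
  qed

  have U_inv: "invertible U" "spectral_norm (matrix_inv U) \<le> 1 + \<epsilon>U"
    using spectral_norm_inv_near_isometry[OF U] e by auto
  note U_inv' = matrix_inv_mult[OF U_inv(1)]

  \<comment> \<open>The exact part of \<open>X\<^sup>*\<close>; \<open>\<Delta>X\<^sup>*\<close> is rewritten as a multiplicative perturbation \<open>H\<close> of it.\<close>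
  define Y where "Y = V ** \<Sigma> ** ctranspose U"
  define Yi where "Yi = ctranspose (matrix_inv U) ** ?\<Sigma>i ** ctranspose V"
  have "Yi ** Y = ctranspose (matrix_inv U) ** (?\<Sigma>i ** (ctranspose V ** V) ** \<Sigma>) ** ctranspose U"
    unfolding Y_def Yi_def by (simp only: matrix_mul_assoc)
  also have "\<dots> = ctranspose (U ** matrix_inv U)"
    by (simp add: VV ctranspose_mult)
  finally have YiY: "Yi ** Y = mat 1" by (simp add: U_inv')
  then have YYi: "Y ** Yi = mat 1" by (simp add: matrix_left_right_inverse)
  define H where "H = ctranspose \<Delta>X ** Yi"
  have XY: "ctranspose X = (mat 1 + H) ** Y"
  proof -
    have "ctranspose X = Y + ctranspose \<Delta>X"
      unfolding X Y_def by (simp add: ctranspose_add ctranspose_mult ctranspose_eq matrix_mul_assoc)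
    also have "ctranspose \<Delta>X = H ** Y" by (simp add: H_def YiY flip: matrix_mul_assoc)
    finally show ?thesis by (simp add: matrix_mult_add_left)
  qed
  have "spectral_norm Yi
      \<le> spectral_norm (ctranspose (matrix_inv U) ** ?\<Sigma>i) * spectral_norm (ctranspose V)"
    unfolding Yi_def by (rule spectral_norm_mult_le)
  also have "\<dots> \<le> spectral_norm (ctranspose (matrix_inv U) ** ?\<Sigma>i) * 1"
    by (intro mult_left_mono spectral_norm_unitary_le unitary_ctranspose V spectral_norm_nonneg)
  also have "\<dots> \<le> spectral_norm (matrix_inv U) * spectral_norm ?\<Sigma>i"
    using spectral_norm_mult_le[of "ctranspose (matrix_inv U)" ?\<Sigma>i] by simp
  also have "\<dots> \<le> (1 + \<epsilon>U) * spectral_norm ?\<Sigma>i"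
    by (intro mult_right_mono U_inv(2) spectral_norm_nonneg)
  finally have Yi_norm: "spectral_norm Yi \<le> (1 + \<epsilon>U) * spectral_norm ?\<Sigma>i" .
  have "norm H \<le> norm \<Delta>X * spectral_norm Yi"
    using frobenius_mult_le_spectral_right[of "ctranspose \<Delta>X" Yi] by (simp add: H_def)
  also have "\<dots> \<le> h"
    unfolding h_def using eps_nonneg \<Delta>X_norm Yi_norm by (intro mult_mono) auto
  finally have H: "norm H \<le> h" .

  have "invertible (mat 1 + H)" using H eh eps_nonneg(2) by (intro invertible_mat_1_plus) simp
  then have "invertible (ctranspose X)"
    unfolding XY using YYi YiY by (intro invertible_mult) (auto simp: invertible_def)
  then have "invertible X"
  proof -
    assume "invertible (ctranspose X)"
    from matrix_inv_mult(1)[OF this] have "ctranspose (ctranspose X ** matrix_inv (ctranspose X)) = mat 1"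
      by simp
    then show ?thesis by (auto simp only: ctranspose_mult ctranspose_ctranspose invertible_left_inverse)
  qed
  then obtain K where K: "\<Delta>X = X ** K" "norm K \<le> \<eta>"
    using row_scaled_perturbation[OF DZ(1) _ DZ(2,3) \<Delta>X eps_nonneg(1)] unfolding \<eta>_def n_def by blast
  \<comment> \<open>The a priori bound \<open>9/40\<close> on \<open>H\<close> absorbs the quadratic term of \<open>H = K\<^sup>* + K\<^sup>*H\<close>.\<close>
  have "H = ctranspose K ** ctranspose X ** Yi"
    by (simp only: H_def K(1) ctranspose_mult)
  also have "\<dots> = ctranspose K ** (mat 1 + H) ** (Y ** Yi)"
    by (simp only: XY matrix_mul_assoc)
  finally have "H = ctranspose K + ctranspose K ** H" by (simp add: YYi matrix_add_ldistrib)
  then have "norm H \<le> norm K + norm K * norm H"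
    using norm_triangle_ineq[of "ctranspose K" "ctranspose K ** H"] frobenius_mult_le[of "ctranspose K" H]
    by simp
  also have "\<dots> \<le> \<eta> + \<eta> * (9/40)"
    using K(2) H eh eps_nonneg(2) order_trans[OF norm_ge_zero K(2)]
    by (intro add_mono mult_mono) auto
  finally have H\<eta>: "norm H \<le> 49/40 * \<eta>" by simp

  \<comment> \<open>Moving \<open>H\<close> past \<open>V\<close> brings \<open>X\<^sup>*U\<close> into the form required by the R factor estimate.\<close>
  define M where "M = ctranspose V ** H ** V"
  have norm_M: "norm M = norm H"
    by (simp add: M_def norm_unitary_mult_left norm_unitary_mult_right unitary_ctranspose V)
  have "V ** M = (V ** ctranspose V) ** H ** V" by (simp only: M_def matrix_mul_assoc)
  then have "V ** (mat 1 + M) = (mat 1 + H) ** V"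
    by (simp add: VV matrix_add_ldistrib matrix_mult_add_left)
  then have "ctranspose X ** U = V ** (mat 1 + M) ** \<Sigma> ** W"
    by (simp add: XY Y_def W_def matrix_mul_assoc)
  then have "is_QR (V ** (mat 1 + M) ** \<Sigma> ** W) Q\<^sub>1 R\<^sub>1" using QR by simp
  moreover have "ctranspose W = W" by (simp add: W_def ctranspose_mult)
  ultimately have R\<^sub>1: "norm (?\<Sigma>i ** R\<^sub>1 - mat 1) \<le> 15/4 * \<epsilon>U + 12/5 * norm H"
    using H eh U by (intro R_factor_left_scaled_perturbation[OF _ _ _ _ _ V]) (auto simp: W_def norm_M)

  have "ctranspose U ** Y\<^sub>1 = ctranspose (ctranspose X ** U) ** Q\<^sub>1"
    by (simp add: Y\<^sub>1 ctranspose_mult matrix_mul_assoc)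
  also have "\<dots> = ctranspose R\<^sub>1 ** (ctranspose Q\<^sub>1 ** Q\<^sub>1)"
    using QR by (simp add: is_QR_def ctranspose_mult matrix_mul_assoc)
  also have "\<dots> = ctranspose R\<^sub>1" using QR by (simp add: is_QR_def unitary_matrix_def)
  finally have UY: "ctranspose U ** Y\<^sub>1 = ctranspose R\<^sub>1" .
  have "Y\<^sub>1 ** ?\<Sigma>i - U = ctranspose (U ** matrix_inv U) ** (Y\<^sub>1 ** ?\<Sigma>i - U)"
    by (simp add: U_inv')
  also have "\<dots> = ctranspose (matrix_inv U) ** (ctranspose U ** Y\<^sub>1 ** ?\<Sigma>i - W)"
    by (simp add: ctranspose_mult W_def matrix_mult_diff_right matrix_mul_assoc)
  finally have "spectral_norm (Y\<^sub>1 ** ?\<Sigma>i - U)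
      \<le> spectral_norm (ctranspose (matrix_inv U)) * spectral_norm (ctranspose R\<^sub>1 ** ?\<Sigma>i - W)"
    by (simp only: UY spectral_norm_mult_le)
  also have "\<dots> \<le> (1 + \<epsilon>U) * norm (ctranspose R\<^sub>1 ** ?\<Sigma>i - W)"
    using U_inv(2) eps_nonneg by (intro mult_mono spectral_norm_le_frobenius) auto
  also have "\<dots> \<le> (1 + \<epsilon>U) * (15/4 * \<epsilon>U + 12/5 * norm H + \<epsilon>U)"
  proof -
    have "ctranspose (?\<Sigma>i ** R\<^sub>1 - mat 1) = ctranspose R\<^sub>1 ** ?\<Sigma>i - mat 1"
      by (simp add: ctranspose_diff ctranspose_mult ctranspose_inv)
    then have "norm (ctranspose R\<^sub>1 ** ?\<Sigma>i - mat 1) \<le> 15/4 * \<epsilon>U + 12/5 * norm H"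
      using R\<^sub>1 by (metis norm_ctranspose)
    moreover have "norm (ctranspose R\<^sub>1 ** ?\<Sigma>i - W)
        = norm ((ctranspose R\<^sub>1 ** ?\<Sigma>i - mat 1) - (W - mat 1))"
      by simp
    moreover have "norm (W - mat 1) \<le> \<epsilon>U" using U by (simp only: W_def)
    ultimately have "norm (ctranspose R\<^sub>1 ** ?\<Sigma>i - W) \<le> 15/4 * \<epsilon>U + 12/5 * norm H + \<epsilon>U"
      using norm_triangle_ineq4[of "ctranspose R\<^sub>1 ** ?\<Sigma>i - mat 1" "W - mat 1"] by linarith
    then show ?thesis using eps_nonneg by (intro mult_left_mono) auto
  qed
  also have "\<dots> \<le> \<epsilon>U + (1 + \<epsilon>U) * (\<epsilon>U + (sqrt 2 + sqrt 3) * (\<epsilon>U + \<eta>))"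
  proof -
    have "0 \<le> \<eta>" unfolding \<eta>_def using eps_nonneg by (intro mult_nonneg_nonneg) auto
    \<comment> \<open>\<open>3.146 \<le> sqrt 2 + sqrt 3\<close> covers the coefficient \<open>12/5 * 49/40\<close> of \<open>\<eta>\<close>; the part of \<open>15/4 * \<epsilon>U\<close> beyond it is paid for by the isolated summand \<open>\<epsilon>U\<close>.\<close>
    have "1.414 \<le> sqrt 2" by (rule real_le_rsqrt) (simp add: power2_eq_square)
    moreover have "1.732 \<le> sqrt 3" by (rule real_le_rsqrt) (simp add: power2_eq_square)
    ultimately have "3.146 * (\<epsilon>U + \<eta>) \<le> (sqrt 2 + sqrt 3) * (\<epsilon>U + \<eta>)"
      using eps_nonneg \<open>0 \<le> \<eta>\<close> by (intro mult_right_mono) auto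
    then have "15/4 * \<epsilon>U + 12/5 * norm H + \<epsilon>U
        \<le> 0.604 * \<epsilon>U + (\<epsilon>U + (sqrt 2 + sqrt 3) * (\<epsilon>U + \<eta>))"
      using H\<eta> \<open>0 \<le> \<eta>\<close> by (simp add: distrib_left)
    then have "(1 + \<epsilon>U) * (15/4 * \<epsilon>U + 12/5 * norm H + \<epsilon>U)
        \<le> (1 + \<epsilon>U) * (0.604 * \<epsilon>U) + (1 + \<epsilon>U) * (\<epsilon>U + (sqrt 2 + sqrt 3) * (\<epsilon>U + \<eta>))"
      using eps_nonneg by (subst distrib_left[symmetric]) (intro mult_left_mono, auto)
    moreover have "(1 + \<epsilon>U) * (0.604 * \<epsilon>U) \<le> \<epsilon>U"
      using mult_right_mono[OF e eps_nonneg(2)] eps_nonneg(2) by (simp add: algebra_simps)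
    ultimately show ?thesis by linarith
  qed
  finally have first: "spectral_norm (Y\<^sub>1 ** ?\<Sigma>i - U)
      \<le> \<epsilon>U + (1 + \<epsilon>U) * (\<epsilon>U + (sqrt 2 + sqrt 3) * (\<epsilon>U + \<eta>))" .

  have "Y\<^sub>2 = U ** \<Sigma> ** (ctranspose V ** V) + \<Delta>X ** V"
    unfolding Y\<^sub>2 by (subst X) (simp only: matrix_mult_add_left matrix_mul_assoc)
  then have "Y\<^sub>2 ** ?\<Sigma>i = U ** (\<Sigma> ** ?\<Sigma>i) + \<Delta>X ** V ** ?\<Sigma>i"
    by (simp only: VV matrix_mul_rid matrix_mult_add_left matrix_mul_assoc)
  then have "Y\<^sub>2 ** ?\<Sigma>i - U = \<Delta>X ** V ** ?\<Sigma>i" by simp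
  then have "spectral_norm (Y\<^sub>2 ** ?\<Sigma>i - U) \<le> spectral_norm (\<Delta>X ** V) * spectral_norm ?\<Sigma>i"
    by (simp only: spectral_norm_mult_le)
  also have "spectral_norm (\<Delta>X ** V) \<le> norm \<Delta>X"
    using spectral_norm_le_frobenius[of "\<Delta>X ** V"] by (simp add: norm_unitary_mult_right V)
  also have "norm \<Delta>X \<le> n * \<epsilon>SVD * spectral_norm X"
  proof -
    have "sqrt n \<le> n" by (rule real_le_lsqrt) (auto simp: n_def power2_eq_square)
    then have "sqrt n * (\<epsilon>SVD * spectral_norm X) \<le> n * (\<epsilon>SVD * spectral_norm X)"
      using eps_nonneg by (intro mult_right_mono) auto
    then show ?thesis using \<Delta>X_norm by (simp add: mult.assoc)
  qed
  finally have "spectral_norm (Y\<^sub>2 ** ?\<Sigma>i - U)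
      \<le> n * \<epsilon>SVD * spectral_norm X * spectral_norm ?\<Sigma>i"
    by (simp add: mult_right_mono)
  with first show ?thesis by (simp add: \<eta>_def)
qed

end
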